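(* Let $G$ be an abelian group and $\mathbb{F}$ a field. Let $\mathcal{U}$ and $\mathcal{V}$ be $G$-graded $\mathbb{F}$-algebras that are graded simple and such that each of the multiplication algebras $M(\mathcal{U})$ and $M(\mathcal{V})$ satisfies an ordinary polynomial identity. If $\mathcal{U}$ and $\mathcal{V}$ satisfy the same ordinary polynomial identities, then $\dim_{\Gamma(\mathcal{U})}\mathcal{U}=\dim_{\Gamma(\mathcal{V})}\mathcal{V}$.
   Context: Algebras are not assumed associative or unital. A $G$-grading on an $\mathbb{F}$-algebra $\mathcal{U}$ is a decomposition $\mathcal{U}=\bigoplus_{g\in G}\mathcal{U}_g$ with $\mathcal{U}_g\mathcal{U}_h\subseteq\mathcal{U}_{gh}$. A subspace $V$ is homogeneous if $V=\bigoplus_g (V\cap\mathcal{U}_g)$. $\mathcal{U}$ is graded simple if $\mathcal{U}^2\ne 0$ and it has no homogeneous two-sided ideals other than $0$ and $\mathcal{U}$. A graded division algebra is a unital associative graded algebra in which every nonzero homogeneous element is invertible; a graded vector space is a graded module over a graded division algebra, and its dimension is the cardinality of a basis. The multiplication algebra $M(\mathcal{U})$ is the subalgebra of $\mathrm{End}_{\mathbb{F}}\,\mathcal{U}$ generated by all left and right multiplications by elements of $\mathcal{U}$. The graded centroid $\Gamma(\mathcal{U})=(\mathrm{End}_{M(\mathcal{U})}\,\mathcal{U})^{gr}$ is the span of all $M(\mathcal{U})$-module endomorphisms $\varphi$ of $\mathcal{U}$ that are homogeneous, i.e. for which there is $g\in G$ with $\varphi(\mathcal{U}_h)\subseteq\mathcal{U}_{gh}$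 for all $h\in G$. For graded simple $\mathcal{U}$ it is a commutative graded division algebra, and $\mathcal{U}$ is a graded vector space over it. An ordinary polynomial identity of an algebra $\mathcal{U}$ is a polynomial $f(x_1,\dots,x_n)$ in the absolutely free (non-associative) algebra $\mathbb{F}\{X\}$ on a countable set $X$ with $f(u_1,\dots,u_n)=0$ for all $u_i\in\mathcal{U}$. For an associative algebra (such as $M(\mathcal{U})$), polynomials are taken in the free associative algebra $\mathbb{F}\langle X\rangle$, and "satisfies an ordinary polynomial identity" means it has a nonzero identity in $\mathbb{F}\langle X\rangle$. *)

theory Defs
  imports Complex_Main "HOL-Library.Poly_Mapping" "HOL-Library.Function_Algebras"
begin

unbundle cardinal_syntax

section \<open>Free algebras\<close>

text \<open>
  The absolutely free algebra on \<open>nat\<close> has the non-associative monomials as a basis; there is no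
  empty monomial, as algebras need not be unital. The free associative algebra on \<open>nat\<close> has
  the words as a basis.
\<close>

datatype na_monomial = Var nat | Mul na_monomial na_monomial

type_synonym 'f na_poly = "na_monomial \<Rightarrow>\<^sub>0 'f"

type_synonym 'f assoc_poly = "nat list \<Rightarrow>\<^sub>0 'f"


section \<open>Algebras\<close>

definition internal_direct_sum :: "'a::ab_group_add set \<Rightarrow> ('g \<Rightarrow> 'a set) \<Rightarrow> bool" where
  "internal_direct_sum V W \<longleftrightarrow>
     (\<forall>g. W g \<subseteq> V) \<and>
     (\<forall>v\<in>V. \<exists>!c. finite {g. c g \<noteq> 0} \<and> (\<forall>g. c g \<in> W g) \<and> v = (\<Sum>g | c g \<noteq> 0. c g))"

locale nonassoc_algebra = vector_space scale
  for scale :: "'f::field \<Rightarrow> 'a::ab_group_add \<Rightarrow> 'a" (infixr \<open>*s\<close> 75) +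
  fixes mult :: "'a \<Rightarrow> 'a \<Rightarrow> 'a" (infixl \<open>\<odot>\<close> 70)
  assumes linear_mult_left: "Vector_Spaces.linear scale scale (\<lambda>x. a \<odot> x)"
    and linear_mult_right: "Vector_Spaces.linear scale scale (\<lambda>x. x \<odot> a)"
begin

sublocale fun_space: vector_space "\<lambda>c \<phi> x. c *s \<phi> x :: 'a"
  by unfold_locales (auto simp: fun_eq_iff algebra_simps)

definition two_sided_ideal :: "'a set \<Rightarrow> bool" where
  "two_sided_ideal I \<longleftrightarrow> subspace I \<and> (\<forall>a. \<forall>x\<in>I. a \<odot> x \<in> I \<and> x \<odot> a \<in> I)"

definition End :: "('a \<Rightarrow> 'a) set" where
  "End = {\<phi>. Vector_Spaces.linear scale scale \<phi>}"

definition subalgebra_End :: "('a \<Rightarrow> 'a) set \<Rightarrow> bool" where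
  "subalgebra_End A \<longleftrightarrow> A \<subseteq> End \<and> fun_space.subspace A \<and> (\<forall>\<phi>\<in>A. \<forall>\<psi>\<in>A. \<phi> \<circ> \<psi> \<in> A)"

text \<open>Subalgebras are not required to contain the identity map.\<close>

definition mult_algebra :: "('a \<Rightarrow> 'a) set" where
  "mult_algebra = subalgebra_End hull (range (\<lambda>a x. a \<odot> x) \<union> range (\<lambda>a x. x \<odot> a))"

definition mult_algebra_endomorphism :: "('a \<Rightarrow> 'a) \<Rightarrow> bool" where
  "mult_algebra_endomorphism \<phi> \<longleftrightarrow> \<phi> \<in> End \<and> (\<forall>m\<in>mult_algebra. \<forall>x. \<phi> (m x) = m (\<phi> x))"

primrec eval_monomial :: "(nat \<Rightarrow> 'a) \<Rightarrow> na_monomial \<Rightarrow> 'a" where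
  "eval_monomial u (Var i) = u i"
| "eval_monomial u (Mul s t) = eval_monomial u s \<odot> eval_monomial u t"

definition eval_poly :: "(nat \<Rightarrow> 'a) \<Rightarrow> 'f na_poly \<Rightarrow> 'a" where
  "eval_poly u p = (\<Sum>t\<in>Poly_Mapping.keys p. Poly_Mapping.lookup p t *s eval_monomial u t)"

definition polynomial_identity :: "'f na_poly \<Rightarrow> bool" where
  "polynomial_identity p \<longleftrightarrow> (\<forall>u. eval_poly u p = 0)"

definition eval_word_End :: "(nat \<Rightarrow> 'a \<Rightarrow> 'a) \<Rightarrow> nat list \<Rightarrow> 'a \<Rightarrow> 'a" where
  "eval_word_End m w = foldr (\<lambda>i \<phi>. m i \<circ> \<phi>) w id"

definition eval_assoc_poly_End :: "(nat \<Rightarrow> 'a \<Rightarrow> 'a) \<Rightarrow> 'f assoc_poly \<Rightarrow> 'a \<Rightarrow> 'a" where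
  "eval_assoc_poly_End m p =
     (\<lambda>x. \<Sum>w\<in>Poly_Mapping.keys p. Poly_Mapping.lookup p w *s eval_word_End m w x)"

text \<open>
  The empty word is evaluated as the identity map, which need not lie in the multiplication
  algebra. This is harmless: substituting the zero map for all variables shows that the constant
  term of an identity vanishes unless the algebra is zero, in which case every polynomial
  is an identity.
\<close>

definition mult_algebra_PI :: bool where
  "mult_algebra_PI \<longleftrightarrow>
     (\<exists>p. p \<noteq> 0 \<and> (\<forall>m. (\<forall>i. m i \<in> mult_algebra) \<longrightarrow> eval_assoc_poly_End m p = (\<lambda>x. 0)))"

end


section \<open>Graded algebras\<close>

text \<open>The grading group is abelian and written additively.\<close>

locale graded_algebra = nonassoc_algebra scale mult
  for scale :: "'f::field \<Rightarrow> 'a::ab_group_add \<Rightarrow> 'a" (infixr \<open>*s\<close> 75)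
    and mult :: "'a \<Rightarrow> 'a \<Rightarrow> 'a" (infixl \<open>\<odot>\<close> 70) +
  fixes grade :: "'g::ab_group_add \<Rightarrow> 'a set"
  assumes subspace_grade: "subspace (grade g)"
    and direct_sum_grade: "internal_direct_sum UNIV grade"
    and mult_grade: "x \<in> grade g \<Longrightarrow> y \<in> grade h \<Longrightarrow> x \<odot> y \<in> grade (g + h)"
begin

definition homogeneous_subspace :: "'a set \<Rightarrow> bool" where
  "homogeneous_subspace V \<longleftrightarrow> subspace V \<and> internal_direct_sum V (\<lambda>g. V \<inter> grade g)"

definition graded_simple :: bool where
  "graded_simple \<longleftrightarrow>
     (\<exists>a b. a \<odot> b \<noteq> 0) \<and>
     (\<forall>I. two_sided_ideal I \<and> homogeneous_subspace I \<longrightarrow> I = {0} \<or> I = UNIV)"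

definition homogeneous_map :: "('a \<Rightarrow> 'a) \<Rightarrow> bool" where
  "homogeneous_map \<phi> \<longleftrightarrow> (\<exists>g. \<forall>h. \<phi> ` grade h \<subseteq> grade (g + h))"

definition graded_centroid :: "('a \<Rightarrow> 'a) set" where
  "graded_centroid = fun_space.span {\<phi>. mult_algebra_endomorphism \<phi> \<and> homogeneous_map \<phi>}"

text \<open>
  The centroid acts on the algebra by application. The library notions of span and independence
  presuppose a ring of scalars given by a type, hence the explicit version here.
\<close>

definition centroid_basis :: "'a set \<Rightarrow> bool" where
  "centroid_basis B \<longleftrightarrow>
     (\<forall>x. \<exists>S c. finite S \<and> S \<subseteq> B \<and> (\<forall>b\<in>S. c b \<in> graded_centroid) \<and> x = (\<Sum>b\<in>S. c b b)) \<and>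
     (\<forall>S c. finite S \<and> S \<subseteq> B \<and> (\<forall>b\<in>S. c b \<in> graded_centroid) \<and> (\<Sum>b\<in>S. c b b) = 0
        \<longrightarrow> (\<forall>b\<in>S. c b = (\<lambda>x. 0)))"

text \<open>
  A cardinal number, to be compared by \<open>=o\<close>. For a graded simple algebra the graded centroid is
  a commutative graded division algebra, so a basis exists and all bases are equipotent.
\<close>

definition centroid_dim :: "'a rel" where
  "centroid_dim = |SOME B. centroid_basis B|"

end

end

theory Submission
  imports Defs "HOL-Combinatorics.Permutations"
begin

text \<open>
  Write \<open>M\<close> for the multiplication algebra and \<open>\<Gamma>\<close> for the graded centroid. The dimension over
  \<open>\<Gamma>\<close> can be read off from the ordinary identities: it is the largest \<open>k\<close> for which some
  multilinear polynomial that alternates in \<open>k\<close> variables is not an identity.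

  On the one hand, \<open>\<Gamma>\<close> commutes with all multiplications, so a multilinear polynomial acts
  \<open>\<Gamma>\<close>-linearly in each variable. If fewer than \<open>k\<close> elements span the algebra over \<open>\<Gamma>\<close>,
  a polynomial that alternates in \<open>k\<close> variables therefore vanishes
  (\<open>alternating_vanishes\<close>, \<open>alternating_poly_identity\<close>).

  On the other hand, call a set separated if operators in \<open>M\<close> can send any one of its elements to
  any prescribed value and kill the other elements. Given a separated set of \<open>k\<close> elements, these
  operators allow one to write down a multilinear polynomial that takes a nonzero value on the set
  in one order and vanishes on it in all other orders. Its alternation is not an identity
  (\<open>alternating_poly_not_identity\<close>).

  It remains to see that a basis over \<open>\<Gamma>\<close> is finite and separated. A polynomial identity of
  \<open>M\<close> bounds the size of separated sets, because a large one carries a faithful copy of any finite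
  piece of the regular representation of the free associative algebra (\<open>separated_bounded\<close>).
  Graded simplicity gives a density theorem: a homogeneous element outside the \<open>\<Gamma>\<close>-span of a finite
  separated set of homogeneous elements can be added to it
  (\<open>in_centroid_span_if_annihilated\<close>, \<open>separated_insert\<close>). So a largest separated set of
  homogeneous elements spans, and it is a basis. This makes \<open>M\<close> contain all \<open>\<Gamma>\<close>-linear maps,
  whence every other basis, homogeneous or not, is separated as well
  (\<open>centroid_basis_separated\<close>). Applying the two halves to each algebra in turn gives both
  inequalities between the dimensions.
\<close>


section \<open>The multiplication algebra\<close>

context nonassoc_algebra
begin

lemma End_iff:
  "\<phi> \<in> End \<longleftrightarrow> (\<forall>x y. \<phi> (x + y) = \<phi> x + \<phi> y) \<and> (\<forall>c x. \<phi> (c *s x) = c *s \<phi> x)"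
  using vector_space_axioms by (auto simp: End_def Vector_Spaces.linear_iff)

lemma EndD:
  assumes "\<phi> \<in> End"
  shows End_add: "\<phi> (x + y) = \<phi> x + \<phi> y" and End_scale: "\<phi> (c *s x) = c *s \<phi> x"
    and End_zero: "\<phi> 0 = 0" and End_diff: "\<phi> (x - y) = \<phi> x - \<phi> y"
    and End_sum: "\<phi> (sum f I) = (\<Sum>i\<in>I. \<phi> (f i))"
proof -
  interpret Vector_Spaces.linear scale scale \<phi> using assms by (simp add: End_def)
  show "\<phi> (x + y) = \<phi> x + \<phi> y" "\<phi> (c *s x) = c *s \<phi> x" "\<phi> 0 = 0" "\<phi> (x - y) = \<phi> x - \<phi> y"
    "\<phi> (sum f I) = (\<Sum>i\<in>I. \<phi> (f i))"
    by (rule add scale zero diff sum)+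
qed

lemma left_mult_End: "(\<lambda>x. a \<odot> x) \<in> End" and right_mult_End: "(\<lambda>x. x \<odot> a) \<in> End"
  by (simp_all add: End_def linear_mult_left linear_mult_right)

lemmas mult_add_right = End_add[OF left_mult_End]
  and mult_add_left = End_add[OF right_mult_End]
  and mult_scale_right = End_scale[OF left_mult_End]
  and mult_scale_left = End_scale[OF right_mult_End]
  and mult_zero_right = End_zero[OF left_mult_End]
  and mult_zero_left = End_zero[OF right_mult_End]
  and mult_sum_right = End_sum[OF left_mult_End]
  and mult_sum_left = End_sum[OF right_mult_End]

lemma subspace_End: "fun_space.subspace End"
  by (auto simp: fun_space.subspace_def End_iff algebra_simps)

lemma comp_End: "\<phi> \<in> End \<Longrightarrow> \<psi> \<in> End \<Longrightarrow> \<phi> \<circ> \<psi> \<in> End"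
  by (auto simp: End_iff)

lemma subalgebra_mult_algebra: "subalgebra_End mult_algebra"
proof -
  have "subalgebra_End End"
    by (auto simp: subalgebra_End_def subspace_End comp_End)
  moreover have "range (\<lambda>a x. a \<odot> x) \<union> range (\<lambda>a x. x \<odot> a) \<subseteq> End"
    using left_mult_End right_mult_End by auto
  ultimately show ?thesis
    unfolding mult_algebra_def hull_def subalgebra_End_def[abs_def]
    by (fastforce simp: fun_space.subspace_def)
qed

lemma mult_algebra_End: "m \<in> mult_algebra \<Longrightarrow> m \<in> End"
  and subspace_mult_algebra: "fun_space.subspace mult_algebra"
  and comp_mult_algebra: "m \<in> mult_algebra \<Longrightarrow> n \<in> mult_algebra \<Longrightarrow> m \<circ> n \<in> mult_algebra"
  using subalgebra_mult_algebra by (auto simp: subalgebra_End_def)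

lemma left_mult_mult_algebra: "(\<lambda>x. a \<odot> x) \<in> mult_algebra"
  and right_mult_mult_algebra: "(\<lambda>x. x \<odot> a) \<in> mult_algebra"
  by (auto simp: mult_algebra_def intro: hull_inc)

lemma mult_algebra_minimal:
  assumes "m \<in> mult_algebra" and "subalgebra_End A"
    and "\<And>a. (\<lambda>x. a \<odot> x) \<in> A" and "\<And>a. (\<lambda>x. x \<odot> a) \<in> A"
  shows "m \<in> A"
proof -
  have "mult_algebra \<subseteq> A"
    unfolding mult_algebra_def by (rule hull_minimal) (use assms in auto)
  with assms(1) show ?thesis by blast
qed

lemma mult_algebra_closed:
  shows zero_mult_algebra: "(\<lambda>x. 0) \<in> mult_algebra"
    and add_mult_algebra:
      "m \<in> mult_algebra \<Longrightarrow> n \<in> mult_algebra \<Longrightarrow> (\<lambda>x. m x + n x) \<in> mult_algebra"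
    and scale_mult_algebra: "m \<in> mult_algebra \<Longrightarrow> (\<lambda>x. c *s m x) \<in> mult_algebra"
    and diff_mult_algebra:
      "m \<in> mult_algebra \<Longrightarrow> n \<in> mult_algebra \<Longrightarrow> (\<lambda>x. m x - n x) \<in> mult_algebra"
  using fun_space.subspace_0[OF subspace_mult_algebra]
    fun_space.subspace_add[OF subspace_mult_algebra, of m n]
    fun_space.subspace_scale[OF subspace_mult_algebra, of m c]
    fun_space.subspace_diff[OF subspace_mult_algebra, of m n]
  by (simp_all add: zero_fun_def plus_fun_def fun_diff_def)

lemma sum_fun_apply: "(\<Sum>i\<in>I. f i) x = (\<Sum>i\<in>I. (f i x :: 'b::comm_monoid_add))"
  by (induction I rule: infinite_finite_induct) auto

lemma sum_mult_algebra:
  assumes "\<And>i. i \<in> I \<Longrightarrow> m i \<in> mult_algebra"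
  shows "(\<lambda>x. \<Sum>i\<in>I. m i x) \<in> mult_algebra"
proof -
  have "(\<Sum>i\<in>I. m i) \<in> mult_algebra"
    using fun_space.subspace_sum[OF subspace_mult_algebra] assms by blast
  then show ?thesis by (simp add: sum_fun_apply[abs_def] eta_contract_eq)
qed

lemma endomorphism_commutes:
  "mult_algebra_endomorphism \<phi> \<Longrightarrow> m \<in> mult_algebra \<Longrightarrow> \<phi> (m x) = m (\<phi> x)"
  by (simp add: mult_algebra_endomorphism_def)

lemma endomorphism_End: "mult_algebra_endomorphism \<phi> \<Longrightarrow> \<phi> \<in> End"
  by (simp add: mult_algebra_endomorphism_def)

lemma subspace_endomorphisms: "fun_space.subspace (Collect mult_algebra_endomorphism)"
proof (rule fun_space.subspaceI)
  show "0 \<in> Collect mult_algebra_endomorphism"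
    using fun_space.subspace_0[OF subspace_End]
    by (simp add: mult_algebra_endomorphism_def End_zero[OF mult_algebra_End])
next
  fix \<phi> \<psi> assume "\<phi> \<in> Collect mult_algebra_endomorphism" "\<psi> \<in> Collect mult_algebra_endomorphism"
  then show "\<phi> + \<psi> \<in> Collect mult_algebra_endomorphism"
    using fun_space.subspace_add[OF subspace_End, of \<phi> \<psi>]
    by (simp add: mult_algebra_endomorphism_def End_add[OF mult_algebra_End])
next
  fix c \<phi> assume "\<phi> \<in> Collect mult_algebra_endomorphism"
  then show "(\<lambda>x. c *s \<phi> x) \<in> Collect mult_algebra_endomorphism"
    using fun_space.subspace_scale[OF subspace_End, of \<phi> c]
    by (simp add: mult_algebra_endomorphism_def End_scale[OF mult_algebra_End])
qed

text \<open>
  This serves both for the multiplication algebra, which turns out to be the span of its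
  homogeneous elements, and for the graded centroid, which is a span of homogeneous maps by
  definition.
\<close>

lemma comp_span_End:
  assumes S: "S \<subseteq> End" and comp: "\<And>\<phi> \<psi>. \<phi> \<in> S \<Longrightarrow> \<psi> \<in> S \<Longrightarrow> \<phi> \<circ> \<psi> \<in> S"
    and \<phi>: "\<phi> \<in> fun_space.span S" and \<psi>: "\<psi> \<in> fun_space.span S"
  shows "\<phi> \<circ> \<psi> \<in> fun_space.span S"
proof -
  have span_End: "fun_space.span S \<subseteq> End"
    using S subspace_End by (rule fun_space.span_minimal)
  have right: "\<phi> \<circ> \<psi> \<in> fun_space.span S" if "\<psi> \<in> S" "\<phi> \<in> fun_space.span S" for \<phi> \<psi>
    using that(2)
  proof (induction rule: fun_space.span_induct)
    case base
    show ?case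
      unfolding fun_space.subspace_def
      using fun_space.span_zero fun_space.span_add fun_space.span_scale
      by (fastforce simp: zero_fun_def plus_fun_def comp_def)
  next
    case (step \<phi>)
    then show ?case using comp that(1) fun_space.span_base by blast
  qed
  show ?thesis
    using \<psi>
  proof (induction rule: fun_space.span_induct)
    case base
    have "\<phi> \<in> End" using \<phi> span_End by blast
    then show ?case
      unfolding fun_space.subspace_def
      using fun_space.span_zero fun_space.span_add fun_space.span_scale
      by (fastforce simp: zero_fun_def plus_fun_def comp_def End_add End_scale End_zero)
  next
    case (step \<psi>)
    then show ?case using right \<phi> by blast
  qed
qed

section \<open>Separated sets\<close>

text \<open>
  Separation is linear independence over the centroid in the strong form that a density theorem
  supplies: on a finite subset, elements of the multiplication algebra take any prescribed values.
\<close>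

definition separated :: "'a set \<Rightarrow> bool" where
  "separated S \<longleftrightarrow>
     (\<forall>e\<in>S. \<forall>y. \<exists>m\<in>mult_algebra. m e = y \<and> (\<forall>e'\<in>S - {e}. m e' = 0))"

lemma separatedE:
  assumes "separated S" and "e \<in> S"
  obtains m where "m \<in> mult_algebra" and "m e = y" and "\<And>e'. e' \<in> S \<Longrightarrow> e' \<noteq> e \<Longrightarrow> m e' = 0"
  using assms unfolding separated_def by (metis Diff_iff singletonD)

lemma separated_subset: "separated S \<Longrightarrow> T \<subseteq> S \<Longrightarrow> separated T"
  unfolding separated_def by (meson Diff_mono order_refl subsetD)

lemma separated_interpolation:
  assumes "separated E" and "finite E"
  obtains m where "m \<in> mult_algebra" and "\<And>e. e \<in> E \<Longrightarrow> m e = t e"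
proof -
  have "\<forall>e\<in>E. \<exists>m. m \<in> mult_algebra \<and> m e = t e \<and> (\<forall>e'\<in>E - {e}. m e' = 0)"
    using assms(1) unfolding separated_def by blast
  then obtain \<mu> where \<mu>: "\<forall>e\<in>E. \<mu> e \<in> mult_algebra \<and> \<mu> e e = t e \<and> (\<forall>e'\<in>E - {e}. \<mu> e e' = 0)"
    by (rule bchoice[THEN exE])
  show thesis
  proof
    show "(\<lambda>x. \<Sum>e\<in>E. \<mu> e x) \<in> mult_algebra"
      using \<mu> by (intro sum_mult_algebra) blast
    fix e assume "e \<in> E"
    then have "(\<Sum>e'\<in>E. \<mu> e' e) = (\<Sum>e'\<in>E. if e' = e then t e else 0)"
      using \<mu> by (intro sum.cong) auto
    with \<open>e \<in> E\<close> assms(2) show "(\<Sum>e'\<in>E. \<mu> e' e) = t e" by simp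
  qed
qed

text \<open>
  A large separated set would let the multiplication algebra imitate the free associative algebra.
  Index part of the set by the words that are relevant for a given polynomial, and let the \<open>i\<close>-th
  variable act by prepending the letter \<open>i\<close> to the index. The polynomial then sends the vector
  with the empty index to the combination of the indexed vectors given by its own coefficients,
  and separation detects each of these coefficients.
\<close>

lemma separated_bounded:
  assumes PI: mult_algebra_PI and y: "(y :: 'a) \<noteq> 0"
  obtains N where "\<And>S. separated S \<Longrightarrow> finite S \<and> card S \<le> N"
proof -
  obtain p where p: "p \<noteq> 0"
    and identity: "\<And>m. (\<And>i. m i \<in> mult_algebra) \<Longrightarrow> eval_assoc_poly_End m p = (\<lambda>x. 0)"
    using PI unfolding mult_algebra_PI_def by blast
  define L where "L = (\<Union>w\<in>Poly_Mapping.keys p. set w)"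
  define D where "D = (\<Sum>w\<in>Poly_Mapping.keys p. length w)"
  define Words where "Words = {w. set w \<subseteq> L \<and> length w \<le> D}"
  have fin: "finite Words"
    unfolding Words_def by (rule finite_lists_length_le) (simp add: L_def)
  have keys: "Poly_Mapping.keys p \<subseteq> Words"
    by (auto simp: Words_def L_def D_def intro!: member_le_sum)
  have suffix: "w \<in> Words" if "i # w \<in> Words" for i w
    using that by (simp add: Words_def)
  have nil: "[] \<in> Words" by (simp add: Words_def)
  have "finite S \<and> card S \<le> card Words" if S: "separated S" for S
  proof (rule ccontr)
    assume "\<not> (finite S \<and> card S \<le> card Words)"
    then obtain T where T: "T \<subseteq> S" "finite T" "card T = card Words"
      by (meson infinite_arbitrarily_large nle_le obtain_subset_with_card_n)
    then obtain e where "bij_betw e Words T"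
      using fin finite_same_card_bij by metis
    then have inj: "inj_on e Words" and img: "e ` Words = T"
      by (auto simp: bij_betw_def)
    have sep: "separated T" using S T(1) by (rule separated_subset)
    have "\<exists>m. m \<in> mult_algebra \<and> (\<forall>w\<in>Words. i # w \<in> Words \<longrightarrow> m (e w) = e (i # w))" for i
    proof -
      obtain m where "m \<in> mult_algebra" "\<And>x. x \<in> T \<Longrightarrow> m x = e (i # inv_into Words e x)"
        using separated_interpolation[OF sep T(2), of "\<lambda>x. e (i # inv_into Words e x)"] by metis
      then show ?thesis using inj img by (metis imageI inv_into_f_f)
    qed
    then obtain m where m: "\<And>i. m i \<in> mult_algebra"
      and step: "\<And>i w. w \<in> Words \<Longrightarrow> i # w \<in> Words \<Longrightarrow> m i (e w) = e (i # w)"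
      by metis
    have word: "eval_word_End m w (e []) = e w" if "w \<in> Words" for w
      using that
    proof (induction w)
      case (Cons i w)
      then show ?case using suffix[of i w] step[of w i] by (simp add: eval_word_End_def)
    qed (simp add: eval_word_End_def)
    have "eval_assoc_poly_End m p (e []) = 0"
      using identity[OF m] by simp
    then have zero: "(\<Sum>w\<in>Poly_Mapping.keys p. Poly_Mapping.lookup p w *s e w) = 0"
      using word keys by (simp add: eval_assoc_poly_End_def subset_iff)
    obtain v where v: "v \<in> Poly_Mapping.keys p" using p by fastforce
    then have "e v \<in> T" using keys img by blast
    then obtain q where q: "q \<in> mult_algebra" "q (e v) = y"
      and kill: "\<And>x. x \<in> T \<Longrightarrow> x \<noteq> e v \<Longrightarrow> q x = 0"
      using separatedE[OF sep] by metis
    have "q (e w) = (if w = v then y else 0)" if "w \<in> Poly_Mapping.keys p" for w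
      using that v q(2) kill[of "e w"] keys inj img by (auto simp: inj_on_def)
    then have "q (\<Sum>w\<in>Poly_Mapping.keys p. Poly_Mapping.lookup p w *s e w)
        = (\<Sum>w\<in>Poly_Mapping.keys p. if w = v then Poly_Mapping.lookup p v *s y else 0)"
      unfolding End_sum[OF mult_algebra_End[OF q(1)]] End_scale[OF mult_algebra_End[OF q(1)]]
      by (intro sum.cong) auto
    also have "\<dots> = Poly_Mapping.lookup p v *s y" using v by simp
    finally have "Poly_Mapping.lookup p v *s y = 0"
      using zero End_zero[OF mult_algebra_End[OF q(1)]] by simp
    then show False using y v by (simp add: in_keys_iff)
  qed
  then show thesis using that by blast
qed

end

section \<open>Operators given by formal expressions\<close>

text \<open>
  An element of the multiplication algebra is turned into an expression in labels for the elements
  that it multiplies by. The expression can then be read in another algebra.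
\<close>

datatype (dead 'f, labels: 'l) mult_op =
    LMult 'l
  | RMult 'l
  | OpAdd "('f, 'l) mult_op" "('f, 'l) mult_op"
  | OpScale 'f "('f, 'l) mult_op"
  | OpComp "('f, 'l) mult_op" "('f, 'l) mult_op"
  for map: relabel

definition na_var :: "nat \<Rightarrow> 'f::field na_poly" where
  "na_var i = Poly_Mapping.single (Var i) 1"

definition na_scale :: "'f::field \<Rightarrow> 'f na_poly \<Rightarrow> 'f na_poly" where
  "na_scale c p = (\<Sum>t\<in>Poly_Mapping.keys p. Poly_Mapping.single t (c * Poly_Mapping.lookup p t))"

definition na_mult :: "'f::field na_poly \<Rightarrow> 'f na_poly \<Rightarrow> 'f na_poly" where
  "na_mult p q = (\<Sum>(s, t)\<in>Poly_Mapping.keys p \<times> Poly_Mapping.keys q.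
     Poly_Mapping.single (Mul s t) (Poly_Mapping.lookup p s * Poly_Mapping.lookup q t))"

primrec op_poly :: "('f::field, nat) mult_op \<Rightarrow> 'f na_poly \<Rightarrow> 'f na_poly" where
  "op_poly (LMult i) p = na_mult (na_var i) p"
| "op_poly (RMult i) p = na_mult p (na_var i)"
| "op_poly (OpAdd o1 o2) p = op_poly o1 p + op_poly o2 p"
| "op_poly (OpScale c o1) p = na_scale c (op_poly o1 p)"
| "op_poly (OpComp o1 o2) p = op_poly o1 (op_poly o2 p)"

context nonassoc_algebra
begin

lemma eval_poly_superset:
  assumes "finite K" and "Poly_Mapping.keys p \<subseteq> K"
  shows "eval_poly u p = (\<Sum>t\<in>K. Poly_Mapping.lookup p t *s eval_monomial u t)"
  unfolding eval_poly_def
  by (rule sum.mono_neutral_left) (use assms in \<open>auto simp: in_keys_iff\<close>)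

lemma eval_poly_zero: "eval_poly u 0 = 0"
  by (simp add: eval_poly_def)

lemma eval_poly_add: "eval_poly u (p + q) = eval_poly u p + eval_poly u q"
proof -
  let ?K = "Poly_Mapping.keys p \<union> Poly_Mapping.keys q"
  have "eval_poly u r = (\<Sum>t\<in>?K. Poly_Mapping.lookup r t *s eval_monomial u t)"
    if "Poly_Mapping.keys r \<subseteq> ?K" for r
    using that by (intro eval_poly_superset) auto
  from this[of p] this[of q] this[of "p + q"] show ?thesis
    using keys_add[of p q] by (simp add: lookup_add scale_left_distrib sum.distrib)
qed

lemma eval_poly_diff: "eval_poly u (p - q) = eval_poly u p - eval_poly u q"
  using eval_poly_add[of u "p - q" q] by simp

lemma eval_poly_sum: "eval_poly u (sum p I) = (\<Sum>i\<in>I. eval_poly u (p i))"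
  by (induction I rule: infinite_finite_induct) (auto simp: eval_poly_zero eval_poly_add)

lemma eval_poly_single: "eval_poly u (Poly_Mapping.single t c) = c *s eval_monomial u t"
  by (simp add: eval_poly_def)

lemma eval_na_var: "eval_poly u (na_var i) = u i"
  by (simp add: na_var_def eval_poly_single)

lemma eval_na_scale: "eval_poly u (na_scale c p) = c *s eval_poly u p"
  by (simp add: na_scale_def eval_poly_sum eval_poly_single eval_poly_def[of u p] scale_sum_right)

lemma eval_na_mult: "eval_poly u (na_mult p q) = eval_poly u p \<odot> eval_poly u q"
proof -
  have "eval_poly u p \<odot> eval_poly u q =
    (\<Sum>s\<in>Poly_Mapping.keys p. \<Sum>t\<in>Poly_Mapping.keys q.
      (Poly_Mapping.lookup p s *s eval_monomial u s) \<odot>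
      (Poly_Mapping.lookup q t *s eval_monomial u t))"
    unfolding eval_poly_def mult_sum_left by (simp only: mult_sum_right)
  then show ?thesis
    by (simp add: na_mult_def eval_poly_sum eval_poly_single mult_scale_left mult_scale_right
        sum.cartesian_product case_prod_unfold mult.commute)
qed

primrec eval_op :: "('l \<Rightarrow> 'a) \<Rightarrow> ('f, 'l) mult_op \<Rightarrow> 'a \<Rightarrow> 'a" where
  "eval_op u (LMult l) = (\<lambda>x. u l \<odot> x)"
| "eval_op u (RMult l) = (\<lambda>x. x \<odot> u l)"
| "eval_op u (OpAdd o1 o2) = (\<lambda>x. eval_op u o1 x + eval_op u o2 x)"
| "eval_op u (OpScale c o1) = (\<lambda>x. c *s eval_op u o1 x)"
| "eval_op u (OpComp o1 o2) = eval_op u o1 \<circ> eval_op u o2"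

lemma eval_op_poly: "eval_poly u (op_poly o1 p) = eval_op u o1 (eval_poly u p)"
  by (induction o1 arbitrary: p)
    (auto simp: eval_na_mult eval_na_var eval_na_scale eval_poly_add)

lemma eval_op_mult_algebra: "eval_op u o1 \<in> mult_algebra"
  by (induction o1) (auto simp: left_mult_mult_algebra right_mult_mult_algebra add_mult_algebra
      scale_mult_algebra comp_mult_algebra[unfolded comp_def])

lemma eval_op_relabel:
  "(\<And>l. l \<in> labels o1 \<Longrightarrow> u (f l) = v l) \<Longrightarrow> eval_op u (relabel f o1) = eval_op v o1"
  by (induction o1) auto

lemma finite_labels: "finite (labels o1)"
  by (induction o1) auto

lemma mult_algebra_eq_eval_op:
  assumes "m \<in> mult_algebra"
  obtains o1 where "eval_op (\<lambda>a. a) o1 = m"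
proof -
  have "m \<in> range (eval_op (\<lambda>a. a))"
    using assms
  proof (rule mult_algebra_minimal)
    \<comment> \<open>any label will do in an expression for the zero map\<close>
    have "0 = eval_op (\<lambda>a. a) (OpScale 0 (LMult undefined))"
      by (simp add: zero_fun_def)
    then have zero: "0 \<in> range (eval_op (\<lambda>a. a))" by blast
    have add: "eval_op (\<lambda>a. a) o1 + eval_op (\<lambda>a. a) o2 \<in> range (eval_op (\<lambda>a. a))" for o1 o2
      by (rule range_eqI[of _ _ "OpAdd o1 o2"]) (simp add: plus_fun_def)
    have scale: "(\<lambda>x. c *s eval_op (\<lambda>a. a) o1 x) \<in> range (eval_op (\<lambda>a. a))" for c o1
      by (rule range_eqI[of _ _ "OpScale c o1"]) simp
    have comp: "eval_op (\<lambda>a. a) o1 \<circ> eval_op (\<lambda>a. a) o2 \<in> range (eval_op (\<lambda>a. a))" for o1 o2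
      by (rule range_eqI[of _ _ "OpComp o1 o2"]) simp
    have "range (eval_op (\<lambda>a. a)) \<subseteq> End"
      using mult_algebra_End[OF eval_op_mult_algebra] by blast
    moreover have "fun_space.subspace (range (eval_op (\<lambda>a. a)))"
      by (rule fun_space.subspaceI) (auto simp: zero add scale simp del: comp_apply)
    ultimately show "subalgebra_End (range (eval_op (\<lambda>a. a)))"
      unfolding subalgebra_End_def using comp by blast
    show "(\<lambda>x. a \<odot> x) \<in> range (eval_op (\<lambda>a. a))" for a
      by (rule range_eqI[of _ _ "LMult a"]) simp
    show "(\<lambda>x. x \<odot> a) \<in> range (eval_op (\<lambda>a. a))" for a
      by (rule range_eqI[of _ _ "RMult a"]) simp
  qed
  then show thesis using that by blast
qed


section \<open>Alternating identities\<close>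

text \<open>
  The building block \<open>z\<^sub>k\<close> is given by \<open>z\<^sub>0 = b\<close> and
  \<open>z\<^sub>i\<^sub>+\<^sub>1 = P\<^sub>i(x\<^sub>i) \<odot> Q(z\<^sub>i)\<close>. It is linear in each argument \<open>x\<^sub>i\<close>.
\<close>

primrec chain :: "(nat \<Rightarrow> 'a \<Rightarrow> 'a) \<Rightarrow> ('a \<Rightarrow> 'a) \<Rightarrow> 'a \<Rightarrow> (nat \<Rightarrow> 'a) \<Rightarrow> nat \<Rightarrow> 'a" where
  "chain P Q b x 0 = b"
| "chain P Q b x (Suc i) = P i (x i) \<odot> Q (chain P Q b x i)"

end

definition even_perms :: "nat \<Rightarrow> (nat \<Rightarrow> nat) set" where
  "even_perms k = {\<sigma>. \<sigma> permutes {..<k} \<and> evenperm \<sigma>}"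

definition odd_perms :: "nat \<Rightarrow> (nat \<Rightarrow> nat) set" where
  "odd_perms k = {\<sigma>. \<sigma> permutes {..<k} \<and> \<not> evenperm \<sigma>}"

text \<open>
  The difference of two partial sums replaces a sum with signs: that it vanishes when two arguments
  agree is then true in characteristic two as well.
\<close>

definition alternating_sum :: "nat \<Rightarrow> ((nat \<Rightarrow> nat) \<Rightarrow> 'b::ab_group_add) \<Rightarrow> 'b" where
  "alternating_sum k F = (\<Sum>\<sigma>\<in>even_perms k. F \<sigma>) - (\<Sum>\<sigma>\<in>odd_perms k. F \<sigma>)"

primrec chain_poly ::
  "(nat \<Rightarrow> ('f::field, nat) mult_op) \<Rightarrow> ('f, nat) mult_op \<Rightarrow> nat \<Rightarrow> (nat \<Rightarrow> nat) \<Rightarrow> nat \<Rightarrow> 'f na_poly"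
where
  "chain_poly P Q b \<sigma> 0 = na_var b"
| "chain_poly P Q b \<sigma> (Suc i) =
     na_mult (op_poly (P i) (na_var (\<sigma> i))) (op_poly Q (chain_poly P Q b \<sigma> i))"

definition alternating_poly ::
  "(nat \<Rightarrow> ('f::field, nat) mult_op) \<Rightarrow> ('f, nat) mult_op \<Rightarrow> nat \<Rightarrow> nat \<Rightarrow> 'f na_poly" where
  "alternating_poly P Q b k = alternating_sum k (\<lambda>\<sigma>. chain_poly P Q b \<sigma> k)"

lemma finite_even_perms: "finite (even_perms k)"
  using finite_permutations[of "{..<k}"] by (auto simp: even_perms_def)

lemma alternating_sum_equal_arguments:
  assumes ij: "i < k" "j < k" "i \<noteq> j" and eq: "x i = x j"
  shows "alternating_sum k (\<lambda>\<sigma>. F (x \<circ> \<sigma>)) = 0"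
proof -
  let ?\<tau> = "transpose i j"
  have \<tau>: "?\<tau> permutes {..<k}" using ij by (auto intro: permutes_swap_id)
  have "x \<circ> ?\<tau> = x" using eq by (auto simp: transpose_def)
  then have x: "x \<circ> (?\<tau> \<circ> \<sigma>) = x \<circ> \<sigma>" for \<sigma>
    by (metis comp_assoc)
  have parity: "evenperm (?\<tau> \<circ> \<sigma>) \<longleftrightarrow> \<not> evenperm \<sigma>" if "\<sigma> permutes {..<k}" for \<sigma>
    using that ij(3) \<tau>
    by (subst evenperm_comp) (auto simp: evenperm_swap permutation_permutes intro: finite_lessThan)
  have inv: "?\<tau> \<circ> (?\<tau> \<circ> \<sigma>) = \<sigma>" for \<sigma>
    by (simp add: comp_assoc[symmetric])
  have "(\<Sum>\<sigma>\<in>even_perms k. F (x \<circ> \<sigma>)) = (\<Sum>\<sigma>\<in>odd_perms k. F (x \<circ> \<sigma>))"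
    by (rule sum.reindex_bij_witness[where i = "\<lambda>\<sigma>. ?\<tau> \<circ> \<sigma>" and j = "\<lambda>\<sigma>. ?\<tau> \<circ> \<sigma>"])
      (simp_all add: inv x even_perms_def odd_perms_def parity permutes_compose[OF _ \<tau>])
  then show ?thesis by (simp add: alternating_sum_def)
qed

context nonassoc_algebra
begin

lemma eval_chain_poly:
  "eval_poly u (chain_poly P Q b \<sigma> k) =
     chain (\<lambda>i. eval_op u (P i)) (eval_op u Q) (u b) (u \<circ> \<sigma>) k"
  by (induction k) (auto simp: eval_na_var eval_na_mult eval_op_poly)

lemma eval_alternating_poly:
  "eval_poly u (alternating_poly P Q b k) =
     alternating_sum k (\<lambda>\<sigma>. chain (\<lambda>i. eval_op u (P i)) (eval_op u Q) (u b) (u \<circ> \<sigma>) k)"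
  by (simp add: alternating_poly_def alternating_sum_def eval_poly_diff eval_poly_sum
      eval_chain_poly)

definition centroid_linear :: "('a \<Rightarrow> 'a) \<Rightarrow> bool" where
  "centroid_linear T \<longleftrightarrow>
     T \<in> End \<and> (\<forall>\<phi>. mult_algebra_endomorphism \<phi> \<longrightarrow> (\<forall>x. T (\<phi> x) = \<phi> (T x)))"

lemma centroid_linear_mult_algebra: "m \<in> mult_algebra \<Longrightarrow> centroid_linear m"
  unfolding centroid_linear_def using mult_algebra_End endomorphism_commutes by metis

lemma centroid_linear_comp:
  "centroid_linear T \<Longrightarrow> centroid_linear T' \<Longrightarrow> centroid_linear (\<lambda>y. T (T' y))"
  using comp_End[of T T'] by (simp add: centroid_linear_def comp_def)

lemma centroid_linear_left_mult: "centroid_linear T \<Longrightarrow> centroid_linear (\<lambda>y. a \<odot> T y)"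
  and centroid_linear_right_mult: "centroid_linear T \<Longrightarrow> centroid_linear (\<lambda>y. T y \<odot> a)"
  using centroid_linear_mult_algebra[OF left_mult_mult_algebra, of a]
    centroid_linear_mult_algebra[OF right_mult_mult_algebra, of a]
    centroid_linear_comp by blast+

lemma centroid_linear_sum:
  assumes "\<And>i. i \<in> I \<Longrightarrow> centroid_linear (T i)"
  shows "centroid_linear (\<lambda>y. \<Sum>i\<in>I. T i y)"
proof -
  have "(\<lambda>y. \<Sum>i\<in>I. T i y) \<in> End"
    using assms unfolding End_iff centroid_linear_def
    by (auto simp: sum.distrib[symmetric] scale_sum_right intro!: sum.cong)
  then show ?thesis
    using assms by (auto simp: centroid_linear_def End_sum[OF endomorphism_End] intro!: sum.cong)
qed

lemma centroid_linear_diff: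
  assumes "centroid_linear T" and "centroid_linear T'"
  shows "centroid_linear (\<lambda>y. T y - T' y)"
proof -
  have "T - T' \<in> End"
    using assms fun_space.subspace_diff[OF subspace_End] by (simp add: centroid_linear_def)
  then show ?thesis
    using assms by (simp add: centroid_linear_def fun_diff_def End_diff[OF endomorphism_End])
qed

lemma chain_fun_upd: "k \<le> j \<Longrightarrow> chain P Q b (x(j := y)) k = chain P Q b x k"
  by (induction k) auto

lemma centroid_linear_chain:
  assumes P: "\<And>i. P i \<in> mult_algebra" and Q: "Q \<in> mult_algebra"
  shows "j < k \<Longrightarrow> centroid_linear (\<lambda>y. chain P Q b (x(j := y)) k)"
proof (induction k)
  case (Suc k)
  show ?case
  proof (cases "j = k")
    case True
    then show ?thesis
      using centroid_linear_right_mult[OF centroid_linear_mult_algebra[OF P, of k]]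
      by (simp only: chain.simps fun_upd_same chain_fun_upd order_refl)
  next
    case False
    with Suc.prems have "centroid_linear (\<lambda>y. chain P Q b (x(j := y)) k)"
      by (intro Suc.IH) simp
    then have "centroid_linear (\<lambda>y. Q (chain P Q b (x(j := y)) k))"
      by (rule centroid_linear_comp[OF centroid_linear_mult_algebra[OF Q]])
    then have "centroid_linear (\<lambda>y. P k (x k) \<odot> Q (chain P Q b (x(j := y)) k))"
      by (rule centroid_linear_left_mult)
    with False show ?thesis
      by (simp only: chain.simps fun_upd_other not_sym)
  qed
qed simp

text \<open>
  Expanding the arguments one at a time in the given elements leaves only terms whose arguments
  are among these elements, and two of those arguments agree.
\<close>

lemma alternating_vanishes:
  fixes A :: "(nat \<Rightarrow> 'a) \<Rightarrow> 'a"
  assumes linear: "\<And>x j. j < k \<Longrightarrow> centroid_linear (\<lambda>y. A (x(j := y)))"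
    and alternating: "\<And>x i j. i < k \<Longrightarrow> j < k \<Longrightarrow> i \<noteq> j \<Longrightarrow> x i = x j \<Longrightarrow> A x = 0"
    and spanning: "\<And>y. \<exists>S c. finite S \<and> S \<subseteq> B \<and> (\<forall>b\<in>S. mult_algebra_endomorphism (c b)) \<and>
      y = (\<Sum>b\<in>S. c b b)"
    and B: "finite B" "card B < k"
  shows "A x = 0"
proof -
  have "A x = 0" if "n \<le> k" "\<And>i. n \<le> i \<Longrightarrow> i < k \<Longrightarrow> x i \<in> B" for n x
    using that
  proof (induction n arbitrary: x)
    case 0
    then have "card (x ` {..<k}) < card {..<k}"
      using card_mono[OF B(1), of "x ` {..<k}"] B(2) by fastforce
    then have "\<not> inj_on x {..<k}" by (rule pigeonhole)
    then obtain i j where "i < k" "j < k" "i \<noteq> j" "x i = x j"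
      unfolding inj_on_def by blast
    then show ?case by (rule alternating)
  next
    case (Suc n)
    obtain S c where S: "finite S" "S \<subseteq> B" and c: "\<forall>b\<in>S. mult_algebra_endomorphism (c b)"
      and x: "x n = (\<Sum>b\<in>S. c b b)"
      using spanning[of "x n"] by blast
    have zero: "A (x(n := b)) = 0" if "b \<in> S" for b
      by (rule Suc.IH) (use Suc.prems that S in auto)
    have T: "centroid_linear (\<lambda>y. A (x(n := y)))"
      by (rule linear) (use Suc.prems in simp)
    have "A x = A (x(n := \<Sum>b\<in>S. c b b))"
      by (simp only: x[symmetric] fun_upd_triv)
    also have "\<dots> = (\<Sum>b\<in>S. A (x(n := c b b)))"
      using T unfolding centroid_linear_def by (blast intro: End_sum[of "\<lambda>y. A (x(n := y))"])
    also have "\<dots> = (\<Sum>b\<in>S. c b (A (x(n := b))))"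
      using T c unfolding centroid_linear_def by (intro sum.cong refl) blast
    also have "\<dots> = 0"
      using c by (intro sum.neutral) (simp add: zero End_zero[OF endomorphism_End])
    finally show ?case .
  qed
  from this[of k] show ?thesis by simp
qed

text \<open>
  Changing an argument of the permuted tuple means changing one argument of the chain, so every
  summand is linear over the centroid in each variable.
\<close>

lemma alternating_poly_identity:
  assumes "\<And>y. \<exists>S c. finite S \<and> S \<subseteq> B \<and> (\<forall>b\<in>S. mult_algebra_endomorphism (c b)) \<and>
      y = (\<Sum>b\<in>S. c b b)"
    and "finite B" "card B < k"
  shows "polynomial_identity (alternating_poly P Q b k)"
  unfolding polynomial_identity_def eval_alternating_poly
proof
  fix u
  let ?C = "\<lambda>x. chain (\<lambda>i. eval_op u (P i)) (eval_op u Q) (u b) x k"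
  have upd: "x(j := y) \<circ> \<sigma> = (x \<circ> \<sigma>)(inv \<sigma> j := y)" "inv \<sigma> j < k"
    if "\<sigma> permutes {..<k}" "j < k" for x :: "nat \<Rightarrow> 'a" and j y \<sigma>
    using that permutes_inverses[OF that(1)] permutes_in_image[OF permutes_inv[OF that(1)], of j]
    by (auto simp: fun_eq_iff)
  have "centroid_linear (\<lambda>y. ?C (x(j := y) \<circ> \<sigma>))" if "\<sigma> permutes {..<k}" "j < k" for x j \<sigma>
    unfolding upd(1)[OF that]
    by (rule centroid_linear_chain) (use upd(2)[OF that] eval_op_mult_algebra in auto)
  then have "centroid_linear (\<lambda>y. alternating_sum k (\<lambda>\<sigma>. ?C (x(j := y) \<circ> \<sigma>)))"
    if "j < k" for x j
    unfolding alternating_sum_def using that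
    by (intro centroid_linear_diff centroid_linear_sum) (auto simp: even_perms_def odd_perms_def)
  then show "alternating_sum k (\<lambda>\<sigma>. ?C (u \<circ> \<sigma>)) = 0"
  proof (rule alternating_vanishes[where A = "\<lambda>x. alternating_sum k (\<lambda>\<sigma>. ?C (x \<circ> \<sigma>))"])
    show "alternating_sum k (\<lambda>\<sigma>. ?C (x \<circ> \<sigma>)) = 0"
      if "i < k" "j < k" "i \<noteq> j" "x i = x j" for x i j
      using that by (rule alternating_sum_equal_arguments)
  qed (assumption | rule assms)+
qed

text \<open>
  Separation provides \<open>P\<^sub>i\<close> that sends \<open>e\<^sub>i\<close> to \<open>a\<close> and the other \<open>e\<^sub>j\<close> to zero. With
  \<open>b = a \<odot> y\<close> and \<open>Q(b) = y\<close> every step of the chain reproduces \<open>b\<close> on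
  \<open>e\<^sub>0, \<dots>, e\<^sub>k\<^sub>-\<^sub>1\<close>, whereas any other order of these arguments makes the chain vanish from some
  step on. The element \<open>b\<close> and those occurring in \<open>P\<^sub>i\<close> and \<open>Q\<close> become variables beyond the
  first \<open>k\<close>.
\<close>

lemma alternating_poly_not_identity:
  assumes S: "separated S" "finite S" and b: "a \<odot> y = b" "separated {b}" "b \<noteq> 0"
  shows "\<exists>P Q z. \<not> polynomial_identity (alternating_poly P Q z (card S))"
proof -
  define k where "k = card S"
  obtain e where e: "bij_betw e {..<k} S"
    using ex_bij_betw_nat_finite[OF S(2)] by (auto simp: k_def atLeast0LessThan)
  have isolate: "\<exists>m\<in>mult_algebra. m (e i) = a \<and> (\<forall>j<k. j \<noteq> i \<longrightarrow> m (e j) = 0)" if "i < k" for i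
  proof -
    have "e i \<in> S" using e that by (auto simp: bij_betw_def)
    then obtain m where "m \<in> mult_algebra" "m (e i) = a"
      "\<And>e'. e' \<in> S \<Longrightarrow> e' \<noteq> e i \<Longrightarrow> m e' = 0"
      using separatedE[OF S(1)] by metis
    then show ?thesis using e that unfolding bij_betw_def inj_on_def by blast
  qed
  have "\<exists>o1. eval_op (\<lambda>a. a) o1 (e i) = a \<and>
      (\<forall>j<k. j \<noteq> i \<longrightarrow> eval_op (\<lambda>a. a) o1 (e j) = 0)" if i: "i < k" for i
  proof -
    obtain m where m: "m \<in> mult_algebra" "m (e i) = a \<and> (\<forall>j<k. j \<noteq> i \<longrightarrow> m (e j) = 0)"
      using isolate[OF i] by blast
    obtain o1 where "eval_op (\<lambda>a. a) o1 = m" using m(1) by (rule mult_algebra_eq_eval_op)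
    with m(2) show ?thesis by blast
  qed
  then have "\<forall>i\<in>{..<k}. \<exists>o1. eval_op (\<lambda>a. a) o1 (e i) = a \<and>
      (\<forall>j<k. j \<noteq> i \<longrightarrow> eval_op (\<lambda>a. a) o1 (e j) = 0)"
    by simp
  then obtain P where P: "\<forall>i\<in>{..<k}. eval_op (\<lambda>a. a) (P i) (e i) = a \<and>
      (\<forall>j<k. j \<noteq> i \<longrightarrow> eval_op (\<lambda>a. a) (P i) (e j) = 0)"
    by (rule bchoice[THEN exE])
  obtain m where m: "m \<in> mult_algebra" "m b = y"
    using separatedE[OF b(2) singletonI] by blast
  obtain Q where "eval_op (\<lambda>a. a) Q = m" using m(1) by (rule mult_algebra_eq_eval_op)
  with m(2) have Q: "eval_op (\<lambda>a. a) Q b = y" by simp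
  define Z where "Z = insert b (labels Q \<union> (\<Union>i<k. labels (P i)))"
  have "finite Z" by (simp add: Z_def finite_labels)
  then obtain \<iota> :: "'a \<Rightarrow> nat" where \<iota>: "inj_on \<iota> Z"
    using finite_imp_inj_to_nat_seg[of Z] by blast
  define u where "u n = (if n < k then e n else inv_into Z \<iota> (n - k))" for n
  have u: "u (k + \<iota> l) = l" if "l \<in> Z" for l
    using that \<iota> by (simp add: u_def)
  let ?P = "\<lambda>i. relabel (\<lambda>l. k + \<iota> l) (P i)" and ?Q = "relabel (\<lambda>l. k + \<iota> l) Q"
  let ?C = "chain (\<lambda>i. eval_op u (?P i)) (eval_op u ?Q) (u (k + \<iota> b))"
  have P': "eval_op u (?P i) = eval_op (\<lambda>a. a) (P i)" if "i < k" for i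
    by (rule eval_op_relabel) (use that u in \<open>auto simp: Z_def\<close>)
  have Q': "eval_op u ?Q = eval_op (\<lambda>a. a) Q"
    by (rule eval_op_relabel) (use u in \<open>auto simp: Z_def\<close>)
  have b': "u (k + \<iota> b) = b" using u by (simp add: Z_def)
  have id: "?C (u \<circ> id) n = b" if "n \<le> k" for n
    using that
  proof (induction n)
    case (Suc n)
    have "(u \<circ> id) n = e n" using Suc.prems by (simp add: u_def)
    then show ?case using Suc P Q b(1) by (simp only: chain.simps P' Q') simp
  qed (simp only: chain.simps b')
  have permuted: "?C (u \<circ> \<sigma>) k = 0" if \<sigma>: "\<sigma> permutes {..<k}" "\<sigma> \<noteq> id" for \<sigma>
  proof -
    obtain i where i: "\<sigma> i \<noteq> i" using \<sigma>(2) by (auto simp: fun_eq_iff)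
    then have "i < k" using \<sigma>(1) by (meson lessThan_iff permutes_not_in)
    then have "\<sigma> i < k" using permutes_in_image[OF \<sigma>(1), of i] by simp
    have killed: "?C (u \<circ> \<sigma>) (Suc i) = 0"
      using P i \<open>i < k\<close> \<open>\<sigma> i < k\<close> by (simp add: P' u_def mult_zero_left)
    have stays: "?C (u \<circ> \<sigma>) (Suc n) = 0" if "?C (u \<circ> \<sigma>) n = 0" for n
      using that
      by (simp add: mult_zero_right End_zero[OF mult_algebra_End[OF eval_op_mult_algebra]])
    have "?C (u \<circ> \<sigma>) n = 0" if "Suc i \<le> n" for n
      using that by (induction n rule: dec_induct) (rule killed, rule stays)
    then show ?thesis using Suc_leI[OF \<open>i < k\<close>] .
  qed
  have "(\<Sum>\<sigma>\<in>even_perms k. ?C (u \<circ> \<sigma>) k) = (\<Sum>\<sigma>\<in>{id}. ?C (u \<circ> \<sigma>) k)"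
    by (rule sum.mono_neutral_right[OF finite_even_perms])
      (use permuted in \<open>auto simp: even_perms_def permutes_id\<close>)
  moreover have "(\<Sum>\<sigma>\<in>odd_perms k. ?C (u \<circ> \<sigma>) k) = 0"
  proof (rule sum.neutral, rule ballI)
    fix \<sigma> assume "\<sigma> \<in> odd_perms k"
    then have "\<sigma> permutes {..<k}" "\<sigma> \<noteq> id" by (auto simp: odd_perms_def)
    then show "?C (u \<circ> \<sigma>) k = 0" by (rule permuted)
  qed
  ultimately have "eval_poly u (alternating_poly ?P ?Q (k + \<iota> b) k) = b"
    using id[of k] by (simp add: eval_alternating_poly alternating_sum_def)
  then show ?thesis
    using b(3) unfolding polynomial_identity_def k_def by metis
qed

end

section \<open>Homogeneous components\<close>

context graded_algebra
begin

definition component :: "'a \<Rightarrow> 'g \<Rightarrow> 'a" where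
  "component v = (THE c. finite {g. c g \<noteq> 0} \<and> (\<forall>g. c g \<in> grade g) \<and> v = (\<Sum>g | c g \<noteq> 0. c g))"

lemma component_decomposition:
  shows finite_components: "finite {g. component v g \<noteq> 0}"
    and component_grade: "component v g \<in> grade g"
    and sum_components: "(\<Sum>g | component v g \<noteq> 0. component v g) = v"
proof -
  have "\<exists>!c. finite {g. c g \<noteq> 0} \<and> (\<forall>g. c g \<in> grade g) \<and> v = (\<Sum>g | c g \<noteq> 0. c g)"
    using direct_sum_grade by (simp add: internal_direct_sum_def)
  from theI'[OF this] show "finite {g. component v g \<noteq> 0}" "component v g \<in> grade g"
    "(\<Sum>g | component v g \<noteq> 0. component v g) = v"
    unfolding component_def[symmetric] by auto
qed

lemma component_unique:
  assumes "finite {g. c g \<noteq> 0}" and "\<And>g. c g \<in> grade g" and "v = (\<Sum>g | c g \<noteq> 0. c g)"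
  shows "component v = c"
proof -
  have "\<exists>!c. finite {g. c g \<noteq> 0} \<and> (\<forall>g. c g \<in> grade g) \<and> v = (\<Sum>g | c g \<noteq> 0. c g)"
    using direct_sum_grade by (simp add: internal_direct_sum_def)
  then show ?thesis
    unfolding component_def by (rule the1_equality) (use assms in blast)
qed

lemma component_of_homogeneous:
  assumes "x \<in> grade h"
  shows "component x g = (if g = h then x else 0)"
proof -
  have support: "{g. (if g = h then x else 0) \<noteq> 0} = (if x = 0 then {} else {h})" by auto
  have "component x = (\<lambda>g. if g = h then x else 0)"
    by (rule component_unique) (use assms subspace_0[OF subspace_grade] in \<open>auto simp: support\<close>)
  then show ?thesis by simp
qed

lemma sum_components_superset:
  assumes "finite K" and "{g. component v g \<noteq> 0} \<subseteq> K"
  shows "(\<Sum>g\<in>K. component v g) = v"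
proof -
  have "(\<Sum>g\<in>K. component v g) = (\<Sum>g | component v g \<noteq> 0. component v g)"
    by (rule sum.mono_neutral_right) (use assms in auto)
  then show ?thesis by (simp add: sum_components)
qed

lemma component_End: "(\<lambda>v. component v g) \<in> End"
proof -
  have "component (v + w) = (\<lambda>g. component v g + component w g)" for v w
  proof (rule component_unique)
    let ?K = "{g. component v g \<noteq> 0} \<union> {g. component w g \<noteq> 0}"
    have fin: "finite ?K" by (simp add: finite_components)
    have sub: "{g. component v g + component w g \<noteq> 0} \<subseteq> ?K" by auto
    show "finite {g. component v g + component w g \<noteq> 0}"
      using sub fin by (rule finite_subset)
    have "(\<Sum>g | component v g + component w g \<noteq> 0. component v g + component w g)
        = (\<Sum>g\<in>?K. component v g + component w g)"
      by (rule sum.mono_neutral_left) (use fin sub in auto)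
    also have "\<dots> = v + w"
      by (simp only: sum.distrib)
        (rule arg_cong2[where f = "(+)"]; rule sum_components_superset; use fin in auto)
    finally show "v + w =
      (\<Sum>g | component v g + component w g \<noteq> 0. component v g + component w g)" ..
  qed (simp add: subspace_add[OF subspace_grade] component_grade)
  moreover have "component (c *s v) = (\<lambda>g. c *s component v g)" for c v
  proof (rule component_unique)
    have sub: "{g. c *s component v g \<noteq> 0} \<subseteq> {g. component v g \<noteq> 0}" by auto
    show "finite {g. c *s component v g \<noteq> 0}"
      using sub finite_components by (rule finite_subset)
    have "(\<Sum>g | c *s component v g \<noteq> 0. c *s component v g)
        = (\<Sum>g | component v g \<noteq> 0. c *s component v g)"
      by (rule sum.mono_neutral_left) (use finite_components sub in auto)
    then show "c *s v = (\<Sum>g | c *s component v g \<noteq> 0. c *s component v g)"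
      by (simp only: scale_sum_right[symmetric] sum_components)
  qed (simp add: subspace_scale[OF subspace_grade] component_grade)
  ultimately show ?thesis by (simp add: End_iff)
qed

lemma component_homogeneous_map:
  assumes f: "f \<in> End" and degree: "\<And>h. f ` grade h \<subseteq> grade (d + h)"
  shows "component (f x) (d + g) = f (component x g)"
proof -
  let ?K = "insert g {h. component x h \<noteq> 0}"
  have fin: "finite ?K" by (simp add: finite_components)
  have "sum (component x) ?K = x" by (rule sum_components_superset[OF fin]) auto
  then have "f x = (\<Sum>h\<in>?K. f (component x h))"
    using End_sum[OF f, of "component x" ?K] by (simp only:)
  then have "component (f x) (d + g) = (\<Sum>h\<in>?K. component (f (component x h)) (d + g))"
    by (simp only: End_sum[OF component_End])
  also have "\<dots> = (\<Sum>h\<in>?K. if h = g then f (component x g) else 0)"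
  proof (rule sum.cong[OF refl])
    fix h
    have "f (component x h) \<in> grade (d + h)" using degree component_grade by blast
    then show "component (f (component x h)) (d + g) = (if h = g then f (component x g) else 0)"
      by (auto simp: component_of_homogeneous)
  qed
  also have "\<dots> = f (component x g)"
    by (simp only: sum.delta[OF fin]) simp
  finally show ?thesis .
qed

lemma homogeneous_subspaceI:
  assumes V: "subspace V" and components: "\<And>v g. v \<in> V \<Longrightarrow> component v g \<in> V"
  shows "homogeneous_subspace V"
  unfolding homogeneous_subspace_def internal_direct_sum_def
proof (intro conjI allI ballI)
  fix v assume "v \<in> V"
  show "\<exists>!c. finite {g. c g \<noteq> 0} \<and> (\<forall>g. c g \<in> V \<inter> grade g) \<and> v = (\<Sum>g | c g \<noteq> 0. c g)"
  proof (rule ex1I)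
    show "finite {g. component v g \<noteq> 0} \<and> (\<forall>g. component v g \<in> V \<inter> grade g) \<and>
        v = (\<Sum>g | component v g \<noteq> 0. component v g)"
      using components[OF \<open>v \<in> V\<close>] component_grade finite_components sum_components by simp
    fix c assume "finite {g. c g \<noteq> 0} \<and> (\<forall>g. c g \<in> V \<inter> grade g) \<and> v = (\<Sum>g | c g \<noteq> 0. c g)"
    then show "c = component v" using component_unique[of c v] by simp
  qed
qed (use V in auto)

lemma graded_simple_ideal:
  assumes "graded_simple" and "two_sided_ideal I" and "\<And>v g. v \<in> I \<Longrightarrow> component v g \<in> I"
    and "x \<in> I" "x \<noteq> 0"
  shows "I = UNIV"
proof -
  have "subspace I" using assms(2) by (simp add: two_sided_ideal_def)
  then have "homogeneous_subspace I" using assms(3) by (rule homogeneous_subspaceI)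
  with assms(1,2) have "I = {0} \<or> I = UNIV" unfolding graded_simple_def by blast
  with assms(4,5) show ?thesis by blast
qed

lemma left_mult_degree: "a \<in> grade d \<Longrightarrow> (\<lambda>x. a \<odot> x) ` grade h \<subseteq> grade (d + h)"
  and right_mult_degree: "a \<in> grade d \<Longrightarrow> (\<lambda>x. x \<odot> a) ` grade h \<subseteq> grade (d + h)"
  using mult_grade[of a d _ h] mult_grade[of _ h a d] by (auto simp: add.commute)

lemma component_left_mult: "a \<in> grade d \<Longrightarrow> component (a \<odot> x) (d + g) = a \<odot> component x g"
  by (rule component_homogeneous_map[OF left_mult_End left_mult_degree])

lemma component_right_mult: "a \<in> grade d \<Longrightarrow> component (x \<odot> a) (d + g) = component x g \<odot> a"
  by (rule component_homogeneous_map[OF right_mult_End right_mult_degree])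

lemma component_zero: "component 0 g = 0"
  by (rule End_zero[OF component_End])

lemma left_mult_components:
  "a \<odot> x = (\<Sum>d | component a d \<noteq> 0. component a d \<odot> x)"
  by (simp only: mult_sum_left[symmetric] sum_components)

lemma right_mult_components:
  "x \<odot> a = (\<Sum>d | component a d \<noteq> 0. x \<odot> component a d)"
  by (simp only: mult_sum_right[symmetric] sum_components)

text \<open>
  The elements whose products with everything vanish form a homogeneous ideal. If it were the whole
  algebra, all products would vanish.
\<close>

lemma mult_algebra_annihilates_zero_only:
  assumes simple: graded_simple and zero: "\<And>m. m \<in> mult_algebra \<Longrightarrow> m x = 0"
  shows "x = 0"
proof (rule ccontr)
  let ?I = "{x. \<forall>a. a \<odot> x = 0 \<and> x \<odot> a = 0}"
  assume "x \<noteq> 0"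
  have "?I = UNIV"
    using simple
  proof (rule graded_simple_ideal)
    show "two_sided_ideal ?I"
      by (auto simp: two_sided_ideal_def subspace_def mult_add_left mult_add_right mult_zero_left
          mult_zero_right mult_scale_left mult_scale_right)
    show "component v g \<in> ?I" if v: "v \<in> ?I" for v g
    proof -
      have zero: "component a d \<odot> component v g = 0" "component v g \<odot> component a d = 0" for a d
        using v component_left_mult[OF component_grade, of a d v g]
          component_right_mult[OF component_grade, of v a d g]
        by (simp_all add: component_zero)
      have "a \<odot> component v g = 0" for a
        by (subst left_mult_components) (simp only: zero sum.neutral_const)
      moreover have "component v g \<odot> a = 0" for a
        by (subst right_mult_components) (simp only: zero sum.neutral_const)
      ultimately show ?thesis by simp
    qed
    show "x \<in> ?I"
      using zero left_mult_mult_algebra right_mult_mult_algebra by blast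
  qed fact
  then show False using simple unfolding graded_simple_def by blast
qed


section \<open>Density\<close>

lemma homogeneous_map_comp:
  assumes "homogeneous_map \<phi>" and "homogeneous_map \<psi>"
  shows "homogeneous_map (\<phi> \<circ> \<psi>)"
proof -
  obtain d d' where "\<And>h. \<phi> ` grade h \<subseteq> grade (d + h)" "\<And>h. \<psi> ` grade h \<subseteq> grade (d' + h)"
    using assms unfolding homogeneous_map_def by blast
  then have "(\<phi> \<circ> \<psi>) ` grade h \<subseteq> grade (d + d' + h)" for h
    by (fastforce simp: add.assoc)
  then show ?thesis unfolding homogeneous_map_def by blast
qed

lemma mult_algebra_spanned_by_homogeneous:
  "mult_algebra \<subseteq> fun_space.span {m \<in> mult_algebra. homogeneous_map m}"
    (is "_ \<subseteq> fun_space.span ?S")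
proof
  fix m assume "m \<in> mult_algebra"
  then show "m \<in> fun_space.span ?S"
  proof (rule mult_algebra_minimal)
    have "?S \<subseteq> End" using mult_algebra_End by blast
    then show "subalgebra_End (fun_space.span ?S)"
      using fun_space.span_minimal[OF _ subspace_End] comp_span_End[of ?S]
        comp_mult_algebra homogeneous_map_comp
      unfolding subalgebra_End_def by auto
    fix a
    have S: "(\<lambda>x. component a d \<odot> x) \<in> ?S" "(\<lambda>x. x \<odot> component a d) \<in> ?S" for d
      using left_mult_mult_algebra right_mult_mult_algebra left_mult_degree[OF component_grade]
        right_mult_degree[OF component_grade]
      unfolding homogeneous_map_def by blast+
    have "(\<Sum>d | component a d \<noteq> 0. (\<lambda>x. component a d \<odot> x)) \<in> fun_space.span ?S"
      "(\<Sum>d | component a d \<noteq> 0. (\<lambda>x. x \<odot> component a d)) \<in> fun_space.span ?S"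
      by (rule fun_space.span_sum, rule fun_space.span_base, rule S)+
    moreover have "(\<Sum>d | component a d \<noteq> 0. (\<lambda>x. component a d \<odot> x)) = (\<lambda>x. a \<odot> x)"
      "(\<Sum>d | component a d \<noteq> 0. (\<lambda>x. x \<odot> component a d)) = (\<lambda>x. x \<odot> a)"
      by (simp_all only: fun_eq_iff sum_fun_apply left_mult_components[of a, symmetric]
          right_mult_components[of _ a, symmetric]) simp_all
    ultimately show "(\<lambda>x. a \<odot> x) \<in> fun_space.span ?S" "(\<lambda>x. x \<odot> a) \<in> fun_space.span ?S"
      by simp_all
  qed
qed

text \<open>
  The generators split into multiplications by homogeneous elements, so elements of the
  multiplication algebra are sums of homogeneous ones. Taking the part of one degree keeps the
  property of killing a homogeneous element, and this is what makes the ideals and maps below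
  homogeneous.
\<close>

lemma mult_algebra_component:
  assumes "m \<in> mult_algebra"
  shows "\<exists>m'\<in>mult_algebra. \<forall>h. \<forall>x\<in>grade h. m' x = component (m x) (g + h)"
proof -
  have "m \<in> fun_space.span {m \<in> mult_algebra. homogeneous_map m}"
    using assms mult_algebra_spanned_by_homogeneous by blast
  then show ?thesis
  proof (induction rule: fun_space.span_induct)
    case base
    show ?case
    proof (rule fun_space.subspaceI; clarify)
      show "\<exists>m'\<in>mult_algebra. \<forall>h. \<forall>x\<in>grade h. m' x = component (0 x) (g + h)"
        using zero_mult_algebra by (auto simp: component_zero)
    next
      fix m1 m2 n1 n2
      assume "n1 \<in> mult_algebra" "\<forall>h. \<forall>x\<in>grade h. n1 x = component (m1 x) (g + h)"
        "n2 \<in> mult_algebra" "\<forall>h. \<forall>x\<in>grade h. n2 x = component (m2 x) (g + h)"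
      then show "\<exists>m'\<in>mult_algebra. \<forall>h. \<forall>x\<in>grade h. m' x = component ((m1 + m2) x) (g + h)"
        by (intro bexI[of _ "\<lambda>x. n1 x + n2 x"])
          (simp_all add: End_add[OF component_End] add_mult_algebra)
    next
      fix c m n
      assume "n \<in> mult_algebra" "\<forall>h. \<forall>x\<in>grade h. n x = component (m x) (g + h)"
      then show "\<exists>m'\<in>mult_algebra. \<forall>h. \<forall>x\<in>grade h. m' x = component (c *s m x) (g + h)"
        by (intro bexI[of _ "\<lambda>x. c *s n x"])
          (simp_all add: End_scale[OF component_End] scale_mult_algebra)
    qed
  next
    case (step m)
    then obtain d where m: "m \<in> mult_algebra" and d: "\<And>h. m ` grade h \<subseteq> grade (d + h)"
      unfolding homogeneous_map_def by blast
    have "(if g = d then m x else 0) = component (m x) (g + h)" if "x \<in> grade h" for x h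
    proof -
      have "m x \<in> grade (d + h)" using d that by blast
      then show ?thesis by (simp add: component_of_homogeneous)
    qed
    moreover have "(\<lambda>x. if g = d then m x else 0) \<in> mult_algebra"
      using m zero_mult_algebra by (cases "g = d") auto
    ultimately show ?case by (intro bexI[of _ "\<lambda>x. if g = d then m x else 0"]) auto
  qed
qed

lemma graded_centroid_endomorphism:
  "\<phi> \<in> graded_centroid \<Longrightarrow> mult_algebra_endomorphism \<phi>"
proof -
  have "graded_centroid \<subseteq> Collect mult_algebra_endomorphism"
    unfolding graded_centroid_def
    by (rule fun_space.span_minimal[OF _ subspace_endomorphisms]) blast
  then show "\<phi> \<in> graded_centroid \<Longrightarrow> mult_algebra_endomorphism \<phi>" by blast
qed

lemma subspace_graded_centroid: "fun_space.subspace graded_centroid"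
  unfolding graded_centroid_def by (rule fun_space.subspace_span)

lemma sum_graded_centroid:
  assumes "\<And>i. i \<in> I \<Longrightarrow> c i \<in> graded_centroid"
  shows "(\<lambda>x. \<Sum>i\<in>I. c i x) \<in> graded_centroid"
proof -
  have "(\<Sum>i\<in>I. c i) \<in> graded_centroid"
    using fun_space.subspace_sum[OF subspace_graded_centroid] assms by blast
  then show ?thesis by (simp add: sum_fun_apply[abs_def] eta_contract_eq)
qed

lemma diff_graded_centroid:
  "c \<in> graded_centroid \<Longrightarrow> d \<in> graded_centroid \<Longrightarrow> (\<lambda>x. c x - d x) \<in> graded_centroid"
  using fun_space.subspace_diff[OF subspace_graded_centroid, of c d] by (simp add: fun_diff_def)

lemma zero_graded_centroid: "(\<lambda>x. 0) \<in> graded_centroid"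
  using fun_space.subspace_0[OF subspace_graded_centroid] by (simp add: zero_fun_def)

lemma id_graded_centroid: "(\<lambda>x. x) \<in> graded_centroid"
proof -
  have "homogeneous_map (\<lambda>x. x)"
    unfolding homogeneous_map_def by (intro exI[of _ 0]) simp
  then show ?thesis
    unfolding graded_centroid_def
    by (intro fun_space.span_base) (simp add: mult_algebra_endomorphism_def End_iff)
qed

lemma comp_graded_centroid:
  assumes "c \<in> graded_centroid" and "d \<in> graded_centroid"
  shows "(\<lambda>x. c (d x)) \<in> graded_centroid"
proof -
  have "c \<circ> d \<in> graded_centroid"
    using assms unfolding graded_centroid_def
    by (rule comp_span_End[rotated 2])
      (auto simp: mult_algebra_endomorphism_def comp_End homogeneous_map_comp)
  then show ?thesis by (simp add: comp_def)
qed

text \<open>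
  This is the density theorem in the direction that is used. If \<open>m\<close> ranges over the operators that
  kill \<open>E - {e}\<close>, then \<open>m e \<mapsto> m x\<close> is a well-defined map on the whole algebra, it commutes with
  the multiplication algebra, and it shifts degrees by the difference of the degrees of \<open>x\<close> and
  \<open>e\<close>. It is therefore the coefficient of \<open>e\<close> in an expression for \<open>x\<close>.
\<close>

lemma in_centroid_span_if_annihilated:
  assumes simple: graded_simple
    and E: "separated E" "finite E" "\<And>e. e \<in> E \<Longrightarrow> \<exists>d. e \<in> grade d"
    and x: "x \<in> grade dx"
    and ann: "\<And>m. m \<in> mult_algebra \<Longrightarrow> (\<And>e. e \<in> E \<Longrightarrow> m e = 0) \<Longrightarrow> m x = 0"
  shows "\<exists>c. (\<forall>e\<in>E. c e \<in> graded_centroid) \<and> x = (\<Sum>e\<in>E. c e e)"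
proof -
  have "\<forall>e\<in>E. \<forall>y. \<exists>m. m \<in> mult_algebra \<and> m e = y \<and> (\<forall>e'\<in>E - {e}. m e' = 0)"
    using E(1) unfolding separated_def by blast
  then obtain \<mu> where \<mu>: "\<And>e y. e \<in> E \<Longrightarrow> \<mu> e y \<in> mult_algebra"
    and \<mu>_same: "\<And>e y. e \<in> E \<Longrightarrow> \<mu> e y e = y"
    and \<mu>_other: "\<And>e e' y. e \<in> E \<Longrightarrow> e' \<in> E \<Longrightarrow> e' \<noteq> e \<Longrightarrow> \<mu> e y e' = 0"
    by (metis Diff_iff singletonD)
  define \<phi> where "\<phi> e y = \<mu> e y x" for e y
  have welldef: "m x = \<phi> e (m e)"
    if "e \<in> E" "m \<in> mult_algebra" "\<And>e'. e' \<in> E \<Longrightarrow> e' \<noteq> e \<Longrightarrow> m e' = 0" for m e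
  proof -
    have "(\<lambda>v. m v - \<mu> e (m e) v) \<in> mult_algebra"
      using that(2) \<mu>[OF that(1)] by (rule diff_mult_algebra)
    then have "m x - \<mu> e (m e) x = 0"
    proof (rule ann)
      show "m e' - \<mu> e (m e) e' = 0" if "e' \<in> E" for e'
        using that \<open>e \<in> E\<close> \<mu>_same \<mu>_other \<open>e' \<in> E \<Longrightarrow> e' \<noteq> e \<Longrightarrow> m e' = 0\<close>
        by (cases "e' = e") auto
    qed
    then show ?thesis by (simp add: \<phi>_def)
  qed
  have centroid: "\<phi> e \<in> graded_centroid" if e: "e \<in> E" for e
  proof -
    have add: "\<phi> e (y + z) = \<phi> e y + \<phi> e z" for y z
      using welldef[OF e add_mult_algebra[OF \<mu>[OF e, of y] \<mu>[OF e, of z]]] \<mu>_same[OF e]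
        \<mu>_other[OF e]
      by (simp add: \<phi>_def)
    have scale: "\<phi> e (c *s y) = c *s \<phi> e y" for c y
      using welldef[OF e scale_mult_algebra[OF \<mu>[OF e, of y]], of c] \<mu>_same[OF e] \<mu>_other[OF e]
      by (simp add: \<phi>_def)
    have commutes: "\<phi> e (n y) = n (\<phi> e y)" if "n \<in> mult_algebra" for n y
      using welldef[OF e comp_mult_algebra[OF that \<mu>[OF e, of y]]] \<mu>_same[OF e] \<mu>_other[OF e]
        End_zero[OF mult_algebra_End[OF that]]
      by (simp add: \<phi>_def)
    obtain d where d: "e \<in> grade d" using E(3) e by blast
    have "\<phi> e y \<in> grade (dx - d + h)" if y: "y \<in> grade h" for y h
    proof -
      obtain m where m: "m \<in> mult_algebra"
        and component: "\<And>k v. v \<in> grade k \<Longrightarrow> m v = component (\<mu> e y v) (h - d + k)"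
        using mult_algebra_component[OF \<mu>[OF e, of y], of "h - d"] by blast
      have "m e = y"
        using component[OF d] y by (simp add: \<mu>_same[OF e] component_of_homogeneous)
      moreover have "m e' = 0" if "e' \<in> E" "e' \<noteq> e" for e'
        using E(3)[OF that(1)] component \<mu>_other[OF e that] by (auto simp: component_zero)
      ultimately have "\<phi> e y = m x" using welldef[OF e m] by simp
      also have "\<dots> \<in> grade (h - d + dx)"
        by (simp add: component[OF x] component_grade)
      finally show ?thesis by (simp add: algebra_simps)
    qed
    then have "homogeneous_map (\<phi> e)"
      unfolding homogeneous_map_def by blast
    then show ?thesis
      unfolding graded_centroid_def
      by (intro fun_space.span_base)
        (auto simp: mult_algebra_endomorphism_def End_iff add scale commutes)
  qed
  have "x - (\<Sum>e\<in>E. \<phi> e e) = 0"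
    using simple
  proof (rule mult_algebra_annihilates_zero_only)
    fix m assume m: "m \<in> mult_algebra"
    have "(\<lambda>v. m v - (\<Sum>e\<in>E. \<mu> e (m e) v)) \<in> mult_algebra"
      using m \<mu> by (intro diff_mult_algebra sum_mult_algebra) auto
    then have "m x - (\<Sum>e\<in>E. \<mu> e (m e) x) = 0"
    proof (rule ann)
      fix e' assume "e' \<in> E"
      then have "(\<Sum>e\<in>E. \<mu> e (m e) e') = (\<Sum>e\<in>E. if e = e' then m e' else 0)"
        using \<mu>_same \<mu>_other by (intro sum.cong) auto
      then show "m e' - (\<Sum>e\<in>E. \<mu> e (m e) e') = 0"
        using \<open>e' \<in> E\<close> E(2) by simp
    qed
    moreover have "\<mu> e (m e) x = m (\<phi> e e)" if "e \<in> E" for e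
      using endomorphism_commutes[OF graded_centroid_endomorphism[OF centroid[OF that]] m, of e]
      by (simp add: \<phi>_def)
    ultimately show "m (x - (\<Sum>e\<in>E. \<phi> e e)) = 0"
      using mult_algebra_End[OF m] by (simp add: End_diff End_sum)
  qed
  then show ?thesis using centroid by (intro exI[of _ \<phi>]) simp
qed

text \<open>
  The images of \<open>x\<close> under the operators that kill \<open>E\<close> form a homogeneous ideal, which is everything
  as soon as it is not zero.
\<close>

lemma separated_insert:
  assumes simple: graded_simple
    and E: "separated E" "\<And>e. e \<in> E \<Longrightarrow> \<exists>d. e \<in> grade d"
    and x: "x \<in> grade dx"
    and m: "m \<in> mult_algebra" "\<And>e. e \<in> E \<Longrightarrow> m e = 0" "m x \<noteq> 0"
  shows "separated (insert x E)"
proof -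
  define Ann where "Ann = {n \<in> mult_algebra. \<forall>e\<in>E. n e = 0}"
  let ?I = "(\<lambda>n. n x) ` Ann"
  have all: "?I = UNIV"
    using simple
  proof (rule graded_simple_ideal)
    have "subspace ?I"
    proof (rule subspaceI)
      show "0 \<in> ?I"
        by (rule image_eqI[of _ _ "\<lambda>v. 0"]) (auto simp: Ann_def zero_mult_algebra)
    next
      fix y z assume "y \<in> ?I" "z \<in> ?I"
      then obtain n n' where "y = n x" "n \<in> Ann" "z = n' x" "n' \<in> Ann" by blast
      then show "y + z \<in> ?I"
        by (intro image_eqI[of _ _ "\<lambda>v. n v + n' v"]) (auto simp: Ann_def add_mult_algebra)
    next
      fix c y assume "y \<in> ?I"
      then obtain n where "y = n x" "n \<in> Ann" by blast
      then show "c *s y \<in> ?I"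
        by (intro image_eqI[of _ _ "\<lambda>v. c *s n v"]) (auto simp: Ann_def scale_mult_algebra)
    qed
    moreover have "a \<odot> y \<in> ?I" "y \<odot> a \<in> ?I" if y: "y \<in> ?I" for a y
    proof -
      obtain n where n: "y = n x" "n \<in> Ann" using y by blast
      have products: "(\<lambda>v. a \<odot> n v) \<in> Ann" "(\<lambda>v. n v \<odot> a) \<in> Ann"
        using n(2) comp_mult_algebra[OF left_mult_mult_algebra, of n a]
          comp_mult_algebra[OF right_mult_mult_algebra, of n a]
        by (auto simp: Ann_def comp_def mult_zero_left mult_zero_right)
      show "a \<odot> y \<in> ?I" "y \<odot> a \<in> ?I"
        unfolding n(1) by (rule rev_image_eqI[OF products(1)], simp)
          (rule rev_image_eqI[OF products(2)], simp)
    qed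
    ultimately show "two_sided_ideal ?I" by (simp add: two_sided_ideal_def)
    show "component v g \<in> ?I" if v: "v \<in> ?I" for v g
    proof -
      obtain n where n: "v = n x" "n \<in> mult_algebra" "\<forall>e\<in>E. n e = 0"
        using v by (auto simp: Ann_def)
      obtain n' where n': "n' \<in> mult_algebra"
        and component: "\<And>h y. y \<in> grade h \<Longrightarrow> n' y = component (n y) (g - dx + h)"
        using mult_algebra_component[OF n(2), of "g - dx"] by blast
      have "n' e = 0" if "e \<in> E" for e
        using E(2)[OF that] component n(3) that by (auto simp: component_zero)
      then have "n' \<in> Ann" using n' by (simp add: Ann_def)
      moreover have "n' x = component v g" using component[OF x] n(1) by simp
      ultimately show ?thesis by (metis image_eqI)
    qed
    show "m x \<in> ?I" using m(1,2) by (auto simp: Ann_def)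
  qed (rule m(3))
  have Ann: "\<exists>n\<in>mult_algebra. n x = y \<and> (\<forall>e\<in>E. n e = 0)" for y
  proof -
    have "y \<in> ?I" by (simp only: all UNIV_I)
    then obtain n where "n \<in> Ann" "y = n x" by blast
    then show ?thesis unfolding Ann_def by blast
  qed
  show ?thesis
    unfolding separated_def
  proof (intro ballI allI)
    fix e y assume "e \<in> insert x E"
    show "\<exists>n\<in>mult_algebra. n e = y \<and> (\<forall>e'\<in>insert x E - {e}. n e' = 0)"
    proof (cases "e = x")
      case True
      then show ?thesis using Ann[of y] by auto
    next
      case False
      with \<open>e \<in> insert x E\<close> have e: "e \<in> E" by simp
      obtain n where n: "n \<in> mult_algebra" "n e = y" "\<And>e'. e' \<in> E \<Longrightarrow> e' \<noteq> e \<Longrightarrow> n e' = 0"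
        using separatedE[OF E(1) e] by metis
      obtain k where k: "k \<in> mult_algebra" "k x = n x" "\<forall>e\<in>E. k e = 0" using Ann[of "n x"] by blast
      \<comment> \<open>correcting by \<open>k\<close> makes the operator vanish at \<open>x\<close> and keeps its values on \<open>E\<close>\<close>
      have "(\<lambda>v. n v - k v) \<in> mult_algebra" using n(1) k(1) by (rule diff_mult_algebra)
      moreover have "n e - k e = y" using n(2) k(3) e by simp
      moreover have "n e' - k e' = 0" if "e' \<in> insert x E - {e}" for e'
        using that n(3)[of e'] k(2,3) by (cases "e' = x") auto
      ultimately show ?thesis by (intro bexI[of _ "\<lambda>v. n v - k v"] conjI ballI)
    qed
  qed
qed

lemma separated_singleton:
  assumes "graded_simple" and "x \<in> grade d" "x \<noteq> 0"
  shows "separated {x}"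
proof -
  obtain m where "m \<in> mult_algebra" "m x \<noteq> 0"
    using mult_algebra_annihilates_zero_only[OF assms(1)] assms(3) by blast
  then show ?thesis
    using separated_insert[OF assms(1) _ _ assms(2), of "{}" m] by (simp add: separated_def)
qed


section \<open>Bases over the graded centroid\<close>

definition centroid_spanning :: "'a set \<Rightarrow> bool" where
  "centroid_spanning E \<longleftrightarrow>
     (\<forall>x. \<exists>c. (\<forall>e\<in>E. c e \<in> graded_centroid) \<and> x = (\<Sum>e\<in>E. c e e))"

text \<open>
  The bound on the size of separated sets provides a largest one among those that consist of
  homogeneous elements, and density shows that it spans.
\<close>

lemma separated_spanning_exists:
  assumes simple: graded_simple and PI: mult_algebra_PI
  obtains E where "finite E" and "separated E" and "centroid_spanning E"
proof -
  obtain a b where "a \<odot> b \<noteq> 0" using simple unfolding graded_simple_def by blast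
  then obtain N where N: "\<And>S. separated S \<Longrightarrow> finite S \<and> card S \<le> N"
    using separated_bounded[OF PI] by blast
  let ?P = "\<lambda>E. separated E \<and> (\<forall>e\<in>E. \<exists>d. e \<in> grade d)"
  have "?P {}" by (simp add: separated_def)
  then obtain E where E: "?P E" and max: "\<And>F. ?P F \<Longrightarrow> card F \<le> card E"
    using ex_has_greatest_nat[of ?P "{}" card "Suc N"] N by (auto simp: less_Suc_eq_le)
  have fin: "finite E" using E N by blast
  have homogeneous: "\<exists>c. (\<forall>e\<in>E. c e \<in> graded_centroid) \<and> x = (\<Sum>e\<in>E. c e e)"
    if x: "x \<in> grade d" for x d
  proof (rule in_centroid_span_if_annihilated[OF simple _ fin _ x])
    fix m assume m: "m \<in> mult_algebra" "\<And>e. e \<in> E \<Longrightarrow> m e = 0"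
    show "m x = 0"
    proof (rule ccontr)
      assume "m x \<noteq> 0"
      then have "?P (insert x E)" using separated_insert[OF simple _ _ x m] E x by blast
      then have "card (insert x E) \<le> card E" by (rule max)
      moreover have "x \<notin> E" using m(2) \<open>m x \<noteq> 0\<close> by blast
      ultimately show False using fin by simp
    qed
  qed (use E in auto)
  have "centroid_spanning E"
    unfolding centroid_spanning_def
  proof
    fix x
    have "\<forall>d. \<exists>c. (\<forall>e\<in>E. c e \<in> graded_centroid) \<and> component x d = (\<Sum>e\<in>E. c e e)"
      using homogeneous[OF component_grade] by blast
    then obtain c where c: "\<And>d e. e \<in> E \<Longrightarrow> c d e \<in> graded_centroid"
      and component: "\<And>d. component x d = (\<Sum>e\<in>E. c d e e)"
      by metis
    let ?K = "{d. component x d \<noteq> 0}"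
    have "x = (\<Sum>d\<in>?K. component x d)" by (rule sum_components[symmetric])
    also have "\<dots> = (\<Sum>d\<in>?K. \<Sum>e\<in>E. c d e e)"
      by (rule sum.cong[OF refl component])
    also have "\<dots> = (\<Sum>e\<in>E. \<Sum>d\<in>?K. c d e e)"
      by (rule sum.swap)
    finally show "\<exists>c. (\<forall>e\<in>E. c e \<in> graded_centroid) \<and> x = (\<Sum>e\<in>E. c e e)"
      using c by (intro exI[of _ "\<lambda>e y. \<Sum>d\<in>?K. c d e y"]) (simp add: sum_graded_centroid)
  qed
  with E fin show thesis using that by blast
qed

lemma centroid_basis_if_separated_spanning:
  assumes E: "finite E" "separated E" "centroid_spanning E"
  shows "centroid_basis E"
  unfolding centroid_basis_def
proof (intro conjI allI impI)
  show "\<exists>S c. finite S \<and> S \<subseteq> E \<and> (\<forall>b\<in>S. c b \<in> graded_centroid) \<and> x = (\<Sum>b\<in>S. c b b)" for x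
  proof -
    obtain c where "(\<forall>e\<in>E. c e \<in> graded_centroid) \<and> x = (\<Sum>e\<in>E. c e e)"
      using E(3) unfolding centroid_spanning_def by (elim allE exE)
    then show ?thesis by (intro exI[of _ E] exI[of _ c]) (simp add: E(1))
  qed
  fix S c
  assume "finite S \<and> S \<subseteq> E \<and> (\<forall>b\<in>S. c b \<in> graded_centroid) \<and> (\<Sum>b\<in>S. c b b) = 0"
  then have S: "finite S" "S \<subseteq> E" and c: "\<And>b. b \<in> S \<Longrightarrow> mult_algebra_endomorphism (c b)"
    and zero: "(\<Sum>b\<in>S. c b b) = 0"
    using graded_centroid_endomorphism by blast+
  have "c b y = 0" if b: "b \<in> S" for b y
  proof -
    have "b \<in> E" using b S(2) by blast
    then obtain m where m: "m \<in> mult_algebra" "m b = y"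
      "\<And>b'. b' \<in> E \<Longrightarrow> b' \<noteq> b \<Longrightarrow> m b' = 0"
      using separatedE[OF E(2)] by metis
    have "0 = m (\<Sum>b'\<in>S. c b' b')"
      using zero End_zero[OF mult_algebra_End[OF m(1)]] by simp
    also have "\<dots> = (\<Sum>b'\<in>S. c b' (m b'))"
      unfolding End_sum[OF mult_algebra_End[OF m(1)]]
      by (rule sum.cong[OF refl]) (rule endomorphism_commutes[OF c m(1), symmetric])
    also have "\<dots> = (\<Sum>b'\<in>S. if b' = b then c b y else 0)"
      using c m S(2) by (intro sum.cong) (auto simp: End_zero[OF endomorphism_End])
    also have "\<dots> = c b y" using S(1) b by simp
    finally show ?thesis by simp
  qed
  then show "\<forall>b\<in>S. c b = (\<lambda>x. 0)" by blast
qed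

text \<open>
  An arbitrary basis \<open>B\<close> need not be homogeneous, so density does not apply to it. Over the separated
  spanning set \<open>E\<close>, however, the multiplication algebra contains every map that is linear over the
  centroid, in particular the ones that are dual to \<open>B\<close>: send each \<open>e\<close> to the \<open>b\<close>-coordinate of
  \<open>e\<close> applied to the prescribed value.
\<close>

lemma centroid_basis_separated:
  assumes E: "finite E" "separated E" "centroid_spanning E" and B: "centroid_basis B"
  shows "separated B"
  unfolding separated_def
proof (intro ballI allI)
  fix b y assume b: "b \<in> B"
  have "\<forall>e. \<exists>S c. finite S \<and> S \<subseteq> B \<and> (\<forall>b\<in>S. c b \<in> graded_centroid) \<and> e = (\<Sum>b\<in>S. c b b)"
    using B unfolding centroid_basis_def by (elim conjE)
  from choice[OF this] obtain S where
    "\<forall>e. \<exists>c. finite (S e) \<and> S e \<subseteq> B \<and> (\<forall>b\<in>S e. c b \<in> graded_centroid) \<and> e = (\<Sum>b\<in>S e. c b b)"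
    by (rule exE)
  from choice[OF this] obtain c where
    Sc: "\<forall>e. finite (S e) \<and> S e \<subseteq> B \<and> (\<forall>b\<in>S e. c e b \<in> graded_centroid) \<and>
      e = (\<Sum>b\<in>S e. c e b b)"
    by (rule exE)
  then have S: "\<And>e. finite (S e)" "\<And>e. S e \<subseteq> B"
    and c: "\<And>e b. b \<in> S e \<Longrightarrow> c e b \<in> graded_centroid"
    by blast+
  have expand: "(\<Sum>b\<in>S e. c e b b) = e" for e
    using Sc[THEN spec[of _ e]] by (elim conjE) (rule sym)
  define coord where "coord e b' = (if b' \<in> S e then c e b' else (\<lambda>x. 0))" for e b'
  have coord: "coord e b' \<in> graded_centroid" for e b'
    using c zero_graded_centroid by (simp add: coord_def)
  have expand_coord: "(\<Sum>b'\<in>T. coord e b' b') = e" if "finite T" "S e \<subseteq> T" for T e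
  proof -
    have "(\<Sum>b'\<in>T. coord e b' b') = (\<Sum>b'\<in>S e. coord e b' b')"
      by (rule sum.mono_neutral_right) (use that in \<open>auto simp: coord_def\<close>)
    also have "\<dots> = (\<Sum>b'\<in>S e. c e b' b')" by (simp add: coord_def)
    also have "\<dots> = e" by (rule expand)
    finally show ?thesis .
  qed
  obtain m where m: "m \<in> mult_algebra" and prescribed: "\<And>e. e \<in> E \<Longrightarrow> m e = coord e b y"
    using separated_interpolation[OF E(2,1), of "\<lambda>e. coord e b y"] by blast
  have "m b' = (if b' = b then y else 0)" if b': "b' \<in> B" for b'
  proof -
    obtain d where d_conj: "(\<forall>e\<in>E. d e \<in> graded_centroid) \<and> b' = (\<Sum>e\<in>E. d e e)"
      using E(3) unfolding centroid_spanning_def by (elim allE exE)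
    then have d: "d e \<in> graded_centroid" if "e \<in> E" for e
      using that by blast
    have b'_eq: "b' = (\<Sum>e\<in>E. d e e)" using d_conj by (rule conjunct2)
    have d_end: "mult_algebra_endomorphism (d e)" if "e \<in> E" for e
      using graded_centroid_endomorphism[OF d[OF that]] .
    define T where "T = {b, b'} \<union> (\<Union>e\<in>E. S e)"
    have T: "finite T" "T \<subseteq> B" using S E(1) b b' by (auto simp: T_def)
    define k where "k b'' = (\<lambda>x. (\<Sum>e\<in>E. d e (coord e b'' x)) - (if b'' = b' then x else 0))" for b''
    \<comment> \<open>\<open>k b''\<close> compares the coefficients of \<open>b''\<close> in the two expansions of \<open>b'\<close> over \<open>B\<close>:
      through the elements of \<open>E\<close>, and as \<open>b'\<close> itself\<close>
    have k: "k b'' \<in> graded_centroid" for b''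
    proof -
      have "(\<lambda>x. if b'' = b' then x else 0) \<in> graded_centroid"
        by (cases "b'' = b'") (simp_all add: id_graded_centroid zero_graded_centroid)
      moreover have "(\<lambda>x. d e (coord e b'' x)) \<in> graded_centroid" if "e \<in> E" for e
        using d[OF that] coord by (rule comp_graded_centroid)
      then have "(\<lambda>x. \<Sum>e\<in>E. d e (coord e b'' x)) \<in> graded_centroid"
        by (rule sum_graded_centroid)
      ultimately show ?thesis
        unfolding k_def by (intro diff_graded_centroid)
    qed
    have "(\<Sum>b''\<in>T. k b'' b'')
        = (\<Sum>b''\<in>T. \<Sum>e\<in>E. d e (coord e b'' b'')) - (\<Sum>b''\<in>T. if b'' = b' then b'' else 0)"
      by (simp only: k_def sum_subtractf)
    also have "(\<Sum>b''\<in>T. if b'' = b' then b'' else 0) = b'"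
      using T(1) by (simp add: T_def)
    also have "(\<Sum>b''\<in>T. \<Sum>e\<in>E. d e (coord e b'' b'')) = (\<Sum>e\<in>E. \<Sum>b''\<in>T. d e (coord e b'' b''))"
      by (rule sum.swap)
    also have "\<dots> = (\<Sum>e\<in>E. d e e)"
    proof (rule sum.cong[OF refl])
      fix e assume e: "e \<in> E"
      then have "S e \<subseteq> T" by (auto simp: T_def)
      then show "(\<Sum>b''\<in>T. d e (coord e b'' b'')) = d e e"
        using End_sum[OF endomorphism_End[OF d_end[OF e]], of "\<lambda>b''. coord e b'' b''" T]
          expand_coord[OF T(1)] by simp
    qed
    finally have "(\<Sum>b''\<in>T. k b'' b'') = 0" using b'_eq by simp
    then have "\<forall>b''\<in>T. k b'' = (\<lambda>x. 0)"
      using B T k unfolding centroid_basis_def by blast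
    then have "k b y = 0" by (simp add: T_def)
    then have "(\<Sum>e\<in>E. d e (coord e b y)) = (if b' = b then y else 0)"
      by (auto simp: k_def)
    moreover have "m b' = (\<Sum>e\<in>E. d e (m e))"
      using b'_eq End_sum[OF mult_algebra_End[OF m], of "\<lambda>e. d e e" E]
        endomorphism_commutes[OF d_end m]
      by simp
    ultimately show ?thesis using prescribed by simp
  qed
  then show "\<exists>m\<in>mult_algebra. m b = y \<and> (\<forall>e'\<in>B - {b}. m e' = 0)"
    using m b by (intro bexI[of _ m]) auto
qed

lemma centroid_dim_separated_basis:
  assumes "graded_simple" and "mult_algebra_PI"
  obtains B where "centroid_dim = card_of B" and "finite B" and "separated B" and "centroid_basis B"
proof -
  obtain E where E: "finite E" "separated E" "centroid_spanning E"
    using assms by (rule separated_spanning_exists)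
  define B where "B = (SOME B. centroid_basis B)"
  have B: "centroid_basis B"
    unfolding B_def by (rule someI[of _ E]) (rule centroid_basis_if_separated_spanning[OF E])
  have sep: "separated B" using E B by (rule centroid_basis_separated)
  obtain a b where "a \<odot> b \<noteq> 0" using assms(1) unfolding graded_simple_def by blast
  then have "finite B" using separated_bounded[OF assms(2)] sep by metis
  then show thesis using that[of B] B sep by (simp add: centroid_dim_def B_def)
qed

text \<open>
  The chain needs an operator that sends its value \<open>b = a \<odot> y\<close> back to \<open>y\<close>. Graded simplicity
  provides one if \<open>b\<close> is homogeneous.
\<close>

lemma homogeneous_product_exists:
  assumes "graded_simple"
  obtains a y d where "a \<odot> y \<in> grade d" and "a \<odot> y \<noteq> 0"
proof -
  obtain a y where ay: "a \<odot> y \<noteq> 0" using assms unfolding graded_simple_def by blast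
  obtain d where d: "component a d \<odot> y \<noteq> 0"
    using ay left_mult_components[of a y] by (metis (mono_tags, lifting) sum.neutral)
  then obtain h where "component a d \<odot> component y h \<noteq> 0"
    using right_mult_components[of "component a d" y] by (metis (mono_tags, lifting) sum.neutral)
  moreover have "component a d \<odot> component y h \<in> grade (d + h)"
    by (rule mult_grade[OF component_grade component_grade])
  ultimately show thesis using that by blast
qed

lemma not_identity_if_separated:
  assumes simple: graded_simple and S: "separated S" "finite S"
  shows "\<exists>P Q z. \<not> polynomial_identity (alternating_poly P Q z (card S))"
proof -
  obtain a y d where "a \<odot> y \<in> grade d" "a \<odot> y \<noteq> 0"
    using simple by (rule homogeneous_product_exists)
  then show ?thesis
    using alternating_poly_not_identity[OF S refl] separated_singleton[OF simple] by blast
qed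

lemma identity_if_centroid_basis:
  assumes B: "centroid_basis B" "finite B" "card B < k"
  shows "polynomial_identity (alternating_poly P Q z k)"
proof (rule alternating_poly_identity[OF _ B(2,3)])
  show "\<exists>S c. finite S \<and> S \<subseteq> B \<and> (\<forall>b\<in>S. mult_algebra_endomorphism (c b)) \<and> y = (\<Sum>b\<in>S. c b b)"
    for y
    using B(1) graded_centroid_endomorphism unfolding centroid_basis_def by meson
qed

end

theorem corollary9:
  fixes scaleU :: "'f::field \<Rightarrow> 'u::ab_group_add \<Rightarrow> 'u"
    and multU :: "'u \<Rightarrow> 'u \<Rightarrow> 'u"
    and gradU :: "'g::ab_group_add \<Rightarrow> 'u set"
    and scaleV :: "'f \<Rightarrow> 'v::ab_group_add \<Rightarrow> 'v"
    and multV :: "'v \<Rightarrow> 'v \<Rightarrow> 'v"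
    and gradV :: "'g \<Rightarrow> 'v set"
  assumes "graded_algebra scaleU multU gradU"
    and "graded_algebra scaleV multV gradV"
    and "graded_algebra.graded_simple scaleU multU gradU"
    and "graded_algebra.graded_simple scaleV multV gradV"
    and "nonassoc_algebra.mult_algebra_PI scaleU multU"
    and "nonassoc_algebra.mult_algebra_PI scaleV multV"
    and "\<And>p. nonassoc_algebra.polynomial_identity scaleU multU p \<longleftrightarrow>
             nonassoc_algebra.polynomial_identity scaleV multV p"
  shows "graded_algebra.centroid_dim scaleU multU gradU =o
         graded_algebra.centroid_dim scaleV multV gradV"
proof -
  interpret U: graded_algebra scaleU multU gradU by fact
  interpret V: graded_algebra scaleV multV gradV by fact
  obtain B where B: "U.centroid_dim = card_of B" "finite B" "U.separated B" "U.centroid_basis B"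
    using assms(3,5) by (rule U.centroid_dim_separated_basis)
  obtain C where C: "V.centroid_dim = card_of C" "finite C" "V.separated C" "V.centroid_basis C"
    using assms(4,6) by (rule V.centroid_dim_separated_basis)
  have "card B \<le> card C"
    using U.not_identity_if_separated[OF assms(3) B(3,2)] V.identity_if_centroid_basis[OF C(4,2)]
      assms(7) by (meson not_le_imp_less)
  moreover have "card C \<le> card B"
    using V.not_identity_if_separated[OF assms(4) C(3,2)] U.identity_if_centroid_basis[OF B(4,2)]
      assms(7) by (meson not_le_imp_less)
  ultimately have "\<exists>f. bij_betw f B C"
    using B(2) C(2) by (intro finite_same_card_bij) auto
  then show ?thesis using B(1) C(1) by (simp add: card_of_ordIso)
qed

end
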